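(* Let $(\mathcal{G},X)$ be a pseudogroup of computable transformations defined on $X=\mathbb{N}$ which does not satisfy F\o lner's condition. Then $X$ has an effective paradoxical $\mathcal{G}$-decomposition.
   Context: A pseudogroup $\mathcal{G}$ of transformations of a set $X$ is a set of bijections $\rho:S\to T$ between subsets $S,T\subseteq X$ such that: (i) the identity $\mathrm{id}_X$ is in $\mathcal{G}$; (ii) if $\rho:S\to T$ is in $\mathcal{G}$, so is the inverse $\rho^{-1}:T\to S$; (iii) if $\rho_1:S\to T$ and $\rho_2:T\to U$ are in $\mathcal{G}$, so is their composition $\rho_2\circ\rho_1:S\to U$; (iv) if $\rho:S\to T$ is in $\mathcal{G}$ and $S_0$ is a subset of $S$, then the restriction $\rho|S_0$ is in $\mathcal{G}$; (v) if $\rho:S\to T$ is a bijection between two subsets $S,T$ of $X$ and there exists a finite partition $S=\bigcup_{j\le n}S_j$ with $\rho|S_j\in\mathcal{G}$ for $j\in\{1,\dots,n\}$, then $\rho$ is in $\mathcal{G}$. For $\gamma:S\to T$ in $\mathcal{G}$, write $\alpha(\gamma)=S$ for its domain and $\omega(\gamma)=T$ for its range. With $X$ identified with $\mathbb{N}$, a transformation $\rho:S\to T$ from $\mathcal{G}$ is computable if $S$ and $T$ are computable subsets of $\mathbb{N}$ and $\rho$ is a computable function. For $R\subset\mathcal{G}$ and $A\subset X$, put $R^{-1}=\{\rho^{-1}:\rho\in R\}$ and $$\partial_R A=\{x\in X\setminus A:\ \exists\rho\in R\cup R^{-1}\ (x\in\alpha(\rho)\text{ and }\rho(x)\in A)\}.$$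 $\mathcal{G}$ satisfies F\o lner's condition if for any finite subset $R$ of $\mathcal{G}$ and any natural number $n$ there exists a finite non-empty subset $F$ of $X$ such that $|\partial_R F|<\frac1n|F|$. An effective paradoxical $\mathcal{G}$-decomposition of $X=\mathbb{N}$ is a tuple $(X_1,X_2,\gamma_1,\gamma_2)$ consisting of a non-trivial partition $X=X_1\sqcup X_2$ into computable sets and computable $\gamma_i\in\mathcal{G}$ with $\alpha(\gamma_i)=X_i$ and $\omega(\gamma_i)=X$ for $i=1,2$.
   Formalization: Axiom (iv), closure under restriction, is required only for computable subsets S_0; for arbitrary subsets no pseudogroup consists of computable transformations, since the identity restricted to a non-computable set would belong to it. *)

theory Defs
  imports Complex_Main "HOL-Library.Disjoint_Sets"
begin

section \<open>Computable functions and sets\<close>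

text \<open>
  Programs for the partial recursive functions. Arities are not tracked in the type: a program
  is run on an argument list, and is undefined if the list is too short.
\<close>

datatype recf =
    Zero
  | Succ
  | Proj nat
  | Comp recf "recf list"
  | PrimRec recf recf
  | Mu recf

primrec run :: "recf \<Rightarrow> nat list \<Rightarrow> nat option" where
  "run Zero = (\<lambda>xs. Some 0)"
| "run Succ = (\<lambda>xs. case xs of [] \<Rightarrow> None | x # _ \<Rightarrow> Some (Suc x))"
| "run (Proj i) = (\<lambda>xs. if i < length xs then Some (xs ! i) else None)"
| "run (Comp f gs) = (\<lambda>xs. Option.bind (those (map (\<lambda>g. g xs) (map run gs))) (run f))"
| "run (PrimRec f g) = (\<lambda>xs. case xs of [] \<Rightarrow> None
     | n # ys \<Rightarrow> rec_nat (run f ys) (\<lambda>k r. Option.bind r (\<lambda>v. run g (k # v # ys))) n)"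
| "run (Mu f) = (\<lambda>xs.
     if \<exists>n. run f (n # xs) = Some 0 \<and> (\<forall>m<n. run f (m # xs) \<noteq> None)
     then Some (LEAST n. run f (n # xs) = Some 0) else None)"

definition partial_computable :: "(nat \<rightharpoonup> nat) \<Rightarrow> bool" where
  "partial_computable f \<longleftrightarrow> (\<exists>p. \<forall>x. run p [x] = f x)"

definition computable_set :: "nat set \<Rightarrow> bool" where
  "computable_set A \<longleftrightarrow> partial_computable (\<lambda>x. Some (if x \<in> A then 1 else 0))"


section \<open>Pseudogroups\<close>

text \<open>
  The set \<open>X\<close> is the whole type \<^typ>\<open>'a\<close>. A bijection \<open>\<rho> : S \<rightarrow> T\<close> between subsets of \<open>X\<close> is an
  injective partial map with \<open>dom \<rho> = S\<close> and \<open>ran \<rho> = T\<close>, so that \<open>\<alpha>(\<rho>) = dom \<rho>\<close> and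
  \<open>\<omega>(\<rho>) = ran \<rho>\<close>.
\<close>

definition partial_bij :: "('a \<rightharpoonup> 'a) \<Rightarrow> bool" where
  "partial_bij \<rho> \<longleftrightarrow> inj_on \<rho> (dom \<rho>)"

definition map_inv :: "('a \<rightharpoonup> 'a) \<Rightarrow> ('a \<rightharpoonup> 'a)" where
  "map_inv \<rho> = (\<lambda>y. if y \<in> ran \<rho> then Some (THE x. \<rho> x = Some y) else None)"

text \<open>
  The family \<open>\<S>\<close> consists of the subsets to which elements may be restricted. The usual notion
  of pseudogroup is the case \<open>\<S> = UNIV\<close>.
\<close>

definition pseudogroup_wrt :: "'a set set \<Rightarrow> ('a \<rightharpoonup> 'a) set \<Rightarrow> bool" where
  "pseudogroup_wrt \<S> G \<longleftrightarrow>
     (\<forall>\<rho>\<in>G. partial_bij \<rho>) \<and>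
     Some \<in> G \<and>
     (\<forall>\<rho>\<in>G. map_inv \<rho> \<in> G) \<and>
     (\<forall>\<rho>\<^sub>1\<in>G. \<forall>\<rho>\<^sub>2\<in>G. ran \<rho>\<^sub>1 = dom \<rho>\<^sub>2 \<longrightarrow> \<rho>\<^sub>2 \<circ>\<^sub>m \<rho>\<^sub>1 \<in> G) \<and>
     (\<forall>\<rho>\<in>G. \<forall>S\<^sub>0\<in>\<S>. S\<^sub>0 \<subseteq> dom \<rho> \<longrightarrow> \<rho> |` S\<^sub>0 \<in> G) \<and>
     (\<forall>\<rho> P. partial_bij \<rho> \<and> finite P \<and> partition_on (dom \<rho>) P \<and> (\<forall>S\<in>P. \<rho> |` S \<in> G)
        \<longrightarrow> \<rho> \<in> G)"

abbreviation pseudogroup :: "('a \<rightharpoonup> 'a) set \<Rightarrow> bool" where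
  "pseudogroup \<equiv> pseudogroup_wrt UNIV"

lemma pseudogroup_wrt_antimono:
  assumes "pseudogroup_wrt \<S> G" and "\<S>' \<subseteq> \<S>"
  shows "pseudogroup_wrt \<S>' G"
proof -
  have "\<forall>\<rho>\<in>G. \<forall>S\<^sub>0\<in>\<S>. S\<^sub>0 \<subseteq> dom \<rho> \<longrightarrow> \<rho> |` S\<^sub>0 \<in> G"
    using assms(1) unfolding pseudogroup_wrt_def by (elim conjE)
  then have "\<forall>\<rho>\<in>G. \<forall>S\<^sub>0\<in>\<S>'. S\<^sub>0 \<subseteq> dom \<rho> \<longrightarrow> \<rho> |` S\<^sub>0 \<in> G"
    using assms(2) by (meson subsetD)
  with assms(1) show ?thesis
    unfolding pseudogroup_wrt_def by (elim conjE, intro conjI)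
qed

definition computable_trans :: "(nat \<rightharpoonup> nat) \<Rightarrow> bool" where
  "computable_trans \<rho> \<longleftrightarrow>
     computable_set (dom \<rho>) \<and> computable_set (ran \<rho>) \<and> partial_computable \<rho>"

text \<open>
  Pseudogroups all of whose elements are computable transformations. Closure under restriction
  has to be confined to computable subsets here: the restriction of the identity to a
  non-computable set is not a computable transformation, so no set of computable
  transformations satisfies \<^const>\<open>pseudogroup\<close>. By \<open>pseudogroup_wrt_antimono\<close>, the condition
  below is implied by \<^const>\<open>pseudogroup\<close> together with computability of all elements. No
  such confinement is needed in the gluing axiom, whose pieces are domains of elements of \<open>G\<close>
  and hence computable.
\<close>

definition computable_pseudogroup :: "(nat \<rightharpoonup> nat) set \<Rightarrow> bool" where
  "computable_pseudogroup G \<longleftrightarrow>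
     pseudogroup_wrt {A. computable_set A} G \<and> (\<forall>\<rho>\<in>G. computable_trans \<rho>)"


section \<open>Folner's condition and paradoxical decompositions\<close>

definition boundary :: "('a \<rightharpoonup> 'a) set \<Rightarrow> 'a set \<Rightarrow> 'a set" where
  "boundary R A = {x. x \<notin> A \<and> (\<exists>\<rho> \<in> R \<union> map_inv ` R. \<exists>y\<in>A. \<rho> x = Some y)}"

definition folner_condition :: "('a \<rightharpoonup> 'a) set \<Rightarrow> bool" where
  "folner_condition G \<longleftrightarrow>
     (\<forall>R n. finite R \<and> R \<subseteq> G \<and> (n::nat) \<ge> 1 \<longrightarrow>
        (\<exists>F. finite F \<and> F \<noteq> {} \<and>
             real (card (boundary R F)) < 1 / real n * real (card F)))"

definition effective_paradoxical_decomposition ::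
    "(nat \<rightharpoonup> nat) set \<Rightarrow> nat set \<Rightarrow> nat set \<Rightarrow> (nat \<rightharpoonup> nat) \<Rightarrow> (nat \<rightharpoonup> nat) \<Rightarrow> bool" where
  "effective_paradoxical_decomposition G X\<^sub>1 X\<^sub>2 \<gamma>\<^sub>1 \<gamma>\<^sub>2 \<longleftrightarrow>
     X\<^sub>1 \<union> X\<^sub>2 = UNIV \<and> X\<^sub>1 \<inter> X\<^sub>2 = {} \<and> X\<^sub>1 \<noteq> {} \<and> X\<^sub>2 \<noteq> {} \<and>
     computable_set X\<^sub>1 \<and> computable_set X\<^sub>2 \<and>
     \<gamma>\<^sub>1 \<in> G \<and> computable_trans \<gamma>\<^sub>1 \<and> dom \<gamma>\<^sub>1 = X\<^sub>1 \<and> ran \<gamma>\<^sub>1 = UNIV \<and>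
     \<gamma>\<^sub>2 \<in> G \<and> computable_trans \<gamma>\<^sub>2 \<and> dom \<gamma>\<^sub>2 = X\<^sub>2 \<and> ran \<gamma>\<^sub>2 = UNIV"

end

theory Submission
  imports Defs "HOL-Library.Nat_Bijection"
begin

text \<open>
  If Folner's condition fails, there is a finite set of elements of \<open>G\<close> under which every finite set
  grows by a fixed factor \<open>q > 1\<close>. Iterating, one obtains a symmetric, decidable, locally finite
  relation \<open>E\<close>, given by finitely many elements of \<open>G\<close>, with \<open>|E(F)| \<ge> 4|F|\<close>. A bijection \<open>f\<close> with
  \<open>(u div 2, f u) \<in> E\<close> then yields the decomposition: \<open>X\<^sub>1\<close> and \<open>X\<^sub>2\<close> are the images of the even and
  the odd numbers, and \<open>f u \<mapsto> u div 2\<close> on each of them is glued from finitely many elements of \<open>G\<close>.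

  Such an \<open>f\<close> is a perfect matching of a bipartite graph in which both sides expand by the factor 2.
  To obtain it computably, a finite matching is extended step by step, so that it always remains
  contained in a perfect matching. By the expansion, only small sets of vertices near the matching
  \<open>M\<close> could violate Hall's condition after the removal of \<open>M\<close>, and these are taken care of by
  exhibiting a finite matching \<open>M' \<supseteq> M\<close> that covers a sufficiently long initial segment on both
  sides. Hence each step is an unbounded search for such a certificate, which is bound to succeed.
\<close>

section \<open>Computable functions of an environment\<close>

text \<open>Programs are run on arbitrarily long prefixes of the environment, which replaces the
  bookkeeping of arities; the bound \<open>k\<close> means that \<open>f\<close> depends on the
  first \<open>k\<close> entries only.\<close>

definition computes :: "recf \<Rightarrow> nat \<Rightarrow> ((nat \<Rightarrow> nat) \<Rightarrow> nat) \<Rightarrow> bool" where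
  "computes p k f \<longleftrightarrow> (\<forall>m\<ge>k. \<forall>e. run p (map e [0..<m]) = Some (f e))"

definition computable :: "((nat \<Rightarrow> nat) \<Rightarrow> nat) \<Rightarrow> bool" where
  "computable f \<longleftrightarrow> (\<exists>p k. computes p k f)"

definition decidable :: "((nat \<Rightarrow> nat) \<Rightarrow> bool) \<Rightarrow> bool" where
  "decidable P \<longleftrightarrow> computable (\<lambda>e. of_bool (P e))"

lemma computableI:
  assumes "\<And>m e. k \<le> m \<Longrightarrow> run p (map e [0..<m]) = Some (f e)"
  shows "computable f"
  using assms unfolding computable_def computes_def by blast

lemma computesD: "computes p k f \<Longrightarrow> k \<le> m \<Longrightarrow> run p (map e [0..<m]) = Some (f e)"
  unfolding computes_def by blast

lemma Cons_map_upt: "x # map e [0..<m] = map (case_nat x e) [0..<Suc m]"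
  by (rule nth_equalityI) (auto simp: nth_Cons split: nat.split simp del: upt_Suc)

lemma computable_var: "computable (\<lambda>e. e i)"
  by (rule computableI[where p = "Proj i" and k = "Suc i"]) auto

lemma computable_zero: "computable (\<lambda>e. 0)"
  by (rule computableI[where p = Zero]) auto

lemma those_map_Some: "those (map (\<lambda>x. Some (f x)) xs) = Some (map f xs)"
  by (induction xs) auto

lemma those_append_Some:
  "those xs = Some us \<Longrightarrow> those ys = Some vs \<Longrightarrow> those (xs @ ys) = Some (us @ vs)"
  by (induction xs arbitrary: us) (auto split: option.splits)

lemma those_runs:
  assumes "\<forall>f\<in>set fs. computable f"
  shows "\<exists>ps k. \<forall>m\<ge>k. \<forall>e.
    those (map (\<lambda>p. run p (map e [0..<m])) ps) = Some (map (\<lambda>f. f e) fs)"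
  using assms
proof (induction fs)
  case Nil
  show ?case by (intro exI[of _ "[]"]) auto
next
  case (Cons f fs)
  then obtain ps k where ps: "\<And>m e. k \<le> m \<Longrightarrow>
      those (map (\<lambda>p. run p (map e [0..<m])) ps) = Some (map (\<lambda>f. f e) fs)"
    by auto
  obtain p l where "computes p l f"
    using Cons.prems unfolding computable_def by auto
  note p = computesD[OF this]
  show ?case
    by (intro exI[of _ "p # ps"] exI[of _ "max k l"]) (auto simp: ps p)
qed

lemma run_Comp: "run (Comp p ps) xs = Option.bind (those (map (\<lambda>q. run q xs) ps)) (run p)"
  by (simp add: comp_def)

lemma computable_subst:
  assumes "computable h" and "\<forall>f\<in>set fs. computable f"
  shows "computable (\<lambda>e. h (\<lambda>i. if i < length fs then (fs ! i) e else 0))"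
proof -
  obtain p k where "computes p k h"
    using assms(1) unfolding computable_def by auto
  note p = computesD[OF this]
  obtain ps l where ps: "\<And>m e. l \<le> m \<Longrightarrow>
      those (map (\<lambda>p. run p (map e [0..<m])) ps) = Some (map (\<lambda>f. f e) fs)"
    using those_runs[OF assms(2)] by auto
  show ?thesis
  \<comment> \<open>The zeros pad the argument list to at least the \<open>k\<close> entries that
    \<open>p\<close> demands.\<close>
  proof (rule computableI[where p = "Comp p (ps @ replicate k Zero)" and k = l])
    fix m and e :: "nat \<Rightarrow> nat" assume m: "l \<le> m"
    let ?e = "\<lambda>i. if i < length fs then (fs ! i) e else 0"
    have z: "those (map (\<lambda>p. run p (map e [0..<m])) (replicate k Zero)) = Some (replicate k 0)"
      using those_map_Some[of "\<lambda>_. 0::nat" "replicate k Zero"] by simp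
    have "map (\<lambda>f. f e) fs @ replicate k 0 = map ?e [0..<length fs + k]"
      by (rule nth_equalityI) (auto simp: nth_append)
    then show "run (Comp p (ps @ replicate k Zero)) (map e [0..<m]) = Some (h ?e)"
      unfolding run_Comp map_append those_append_Some[OF ps[OF m] z] by (simp add: p)
  qed
qed

lemma computable_comp1:
  assumes "computable (\<lambda>e. h (e 0))" and "computable f"
  shows "computable (\<lambda>e. h (f e))"
  using computable_subst[OF assms(1), of "[f]"] assms(2) by simp

lemma computable_comp2:
  assumes "computable (\<lambda>e. h (e 0) (e 1))" and "computable f" and "computable g"
  shows "computable (\<lambda>e. h (f e) (g e))"
  using computable_subst[OF assms(1), of "[f, g]"] assms(2,3) by simp

lemma decidable_comp1:
  assumes "decidable (\<lambda>e. P (e 0))" and "computable f"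
  shows "decidable (\<lambda>e. P (f e))"
  using computable_comp1[of "\<lambda>x. of_bool (P x)"] assms unfolding decidable_def by simp

lemma decidable_comp2:
  assumes "decidable (\<lambda>e. P (e 0) (e 1))" and "computable f" and "computable g"
  shows "decidable (\<lambda>e. P (f e) (g e))"
  using computable_comp2[of "\<lambda>x y. of_bool (P x y)"] assms unfolding decidable_def by simp

lemma computable_Suc:
  assumes "computable f"
  shows "computable (\<lambda>e. Suc (f e))"
proof (rule computable_comp1[OF _ assms])
  show "computable (\<lambda>e. Suc (e 0))"
    by (rule computableI[where p = Succ and k = 1])
      (auto split: list.split simp: upt_conv_Cons)
qed

lemma computable_const: "computable (\<lambda>e. c)"
  by (induction c) (auto intro: computable_zero computable_Suc)

text \<open>Bound variables are treated as de Bruijn indices: they are pushed onto the environment.\<close>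

lemma computable_rec_nat:
  assumes "computable f" and "computable (\<lambda>e. g (e 0) (e (Suc 0)) (\<lambda>i. e (Suc (Suc i))))"
    and "computable n"
  shows "computable (\<lambda>e. rec_nat (f e) (\<lambda>a r. g a r e) (n e))"
proof -
  obtain p k where "computes p k f"
    using assms(1) unfolding computable_def by auto
  note p = computesD[OF this]
  obtain q l where "computes q l (\<lambda>e. g (e 0) (e (Suc 0)) (\<lambda>i. e (Suc (Suc i))))"
    using assms(2) unfolding computable_def by auto
  note q = computesD[OF this]
  obtain s j where "computes s j n"
    using assms(3) unfolding computable_def by auto
  note s = computesD[OF this]
  \<comment> \<open>Both programs receive the same \<open>t\<close> parameters, enough for either;
    the projections in the final program cut the environment down to this prefix.\<close>
  define t where "t = max k l"
  have step: "run q (a # r # map e [0..<t]) = Some (g a r e)" for a r e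
  proof -
    have "l \<le> Suc (Suc t)" by (simp add: t_def)
    from q[OF this, of "case_nat a (case_nat r e)"] show ?thesis
      unfolding Cons_map_upt by simp
  qed
  have rec: "run (PrimRec p q) (x # map e [0..<t]) = Some (rec_nat (f e) (\<lambda>a r. g a r e) x)"
    for x e
  proof (induction x)
    case 0
    show ?case using p[of t e] by (simp add: t_def)
  next
    case (Suc x)
    then show ?case by (simp add: step)
  qed
  show ?thesis
  proof (rule computableI[where p = "Comp (PrimRec p q) (s # map Proj [0..<t])" and k = "max j t"])
    fix m and e :: "nat \<Rightarrow> nat" assume m: "max j t \<le> m"
    have "map (\<lambda>p. run p (map e [0..<m])) (map Proj [0..<t]) = map (\<lambda>i. Some (e i)) [0..<t]"
      using m by auto
    then have "those (map (\<lambda>p. run p (map e [0..<m])) (map Proj [0..<t])) = Some (map e [0..<t])"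
      by (simp only: those_map_Some)
    then have "those (map (\<lambda>p. run p (map e [0..<m])) (s # map Proj [0..<t]))
        = Some (n e # map e [0..<t])"
      using s[of m e] m by simp
    then show "run (Comp (PrimRec p q) (s # map Proj [0..<t])) (map e [0..<m])
        = Some (rec_nat (f e) (\<lambda>a r. g a r e) (n e))"
      unfolding run_Comp using rec by (simp del: run.simps)
  qed
qed

section \<open>Arithmetic functions\<close>

lemma computable_add:
  assumes "computable f" and "computable g"
  shows "computable (\<lambda>e. f e + g e)"
proof -
  have "rec_nat a (\<lambda>_ r. Suc r) b = a + b" for a b :: nat
    by (induction b) auto
  moreover have "computable (\<lambda>e. rec_nat (f e) (\<lambda>_ r. Suc r) (g e))"
    by (intro computable_rec_nat computable_Suc computable_var assms)
  ultimately show ?thesis by simp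
qed

lemma computable_mult:
  assumes "computable f" and "computable g"
  shows "computable (\<lambda>e. f e * g e)"
proof -
  have eq: "rec_nat 0 (\<lambda>_ r. r + a) b = a * b" for a b :: nat
    by (induction b) auto
  have "computable (\<lambda>e. rec_nat 0 (\<lambda>_ r. r + e 0) (e 1))"
    by (intro computable_rec_nat computable_add computable_var computable_const)
  then have "computable (\<lambda>e. e 0 * e 1)" by (simp only: eq)
  then show ?thesis by (rule computable_comp2[OF _ assms])
qed

lemma computable_pow:
  assumes "computable f" and "computable g"
  shows "computable (\<lambda>e. f e ^ g e)"
proof -
  have eq: "rec_nat 1 (\<lambda>_ r. r * a) b = a ^ b" for a b :: nat
    by (induction b) auto
  have "computable (\<lambda>e. rec_nat 1 (\<lambda>_ r. r * e 0) (e 1))"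
    by (intro computable_rec_nat computable_mult computable_var computable_const)
  then have "computable (\<lambda>e. e 0 ^ e 1)" by (simp only: eq)
  then show ?thesis by (rule computable_comp2[OF _ assms])
qed

lemma computable_diff:
  assumes "computable f" and "computable g"
  shows "computable (\<lambda>e. f e - g e)"
proof -
  have eq: "rec_nat 0 (\<lambda>a _. a) b = b - 1" for b :: nat
    by (cases b) auto
  have "computable (\<lambda>e. rec_nat 0 (\<lambda>a _. a) (e 0))"
    by (intro computable_rec_nat computable_var computable_const)
  then have pred: "computable (\<lambda>e. e 0 - 1)" by (simp only: eq)
  have eq': "rec_nat a (\<lambda>_ r. r - 1) b = a - b" for a b :: nat
    by (induction b) auto
  have "computable (\<lambda>e. rec_nat (e 0) (\<lambda>_ r. r - 1) (e 1))"
    by (intro computable_rec_nat computable_var computable_comp1[OF pred])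
  then have "computable (\<lambda>e. e 0 - e 1)" by (simp only: eq')
  then show ?thesis by (rule computable_comp2[OF _ assms])
qed

section \<open>Decidable predicates and bounded quantifiers\<close>

lemma decidable_not:
  assumes "decidable P"
  shows "decidable (\<lambda>e. \<not> P e)"
proof -
  have "computable (\<lambda>e. 1 - of_bool (P e))"
    using assms unfolding decidable_def by (intro computable_diff computable_const)
  moreover have "(\<lambda>e. 1 - of_bool (P e) :: nat) = (\<lambda>e. of_bool (\<not> P e))" by auto
  ultimately show ?thesis unfolding decidable_def by simp
qed

lemma decidable_conj:
  assumes "decidable P" and "decidable Q"
  shows "decidable (\<lambda>e. P e \<and> Q e)"
proof -
  have "computable (\<lambda>e. of_bool (P e) * of_bool (Q e))"
    using assms unfolding decidable_def by (rule computable_mult)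
  then show ?thesis unfolding decidable_def by (simp only: of_bool_conj)
qed

lemma decidable_disj:
  assumes "decidable P" and "decidable Q"
  shows "decidable (\<lambda>e. P e \<or> Q e)"
proof -
  have "decidable (\<lambda>e. \<not> (\<not> P e \<and> \<not> Q e))"
    by (intro decidable_not decidable_conj assms)
  then show ?thesis by (simp only: de_Morgan_conj not_not)
qed

lemma decidable_imp:
  assumes "decidable P" and "decidable Q"
  shows "decidable (\<lambda>e. P e \<longrightarrow> Q e)"
  unfolding imp_conv_disj by (intro decidable_disj decidable_not assms)

lemma decidable_iff:
  assumes "decidable P" and "decidable Q"
  shows "decidable (\<lambda>e. P e \<longleftrightarrow> Q e)"
  unfolding iff_conv_conj_imp by (intro decidable_conj decidable_imp assms)

lemma decidable_const: "decidable (\<lambda>e. b)"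
  unfolding decidable_def by (rule computable_const)

lemma computable_if:
  assumes "decidable P" and "computable f" and "computable g"
  shows "computable (\<lambda>e. if P e then f e else g e)"
proof -
  have "computable (\<lambda>e. of_bool (P e) * f e + of_bool (\<not> P e) * g e)"
    using assms decidable_not[OF assms(1)] unfolding decidable_def
    by (intro computable_add computable_mult)
  moreover have "(\<lambda>e. of_bool (P e) * f e + of_bool (\<not> P e) * g e)
      = (\<lambda>e. if P e then f e else g e)"
    by auto
  ultimately show ?thesis by simp
qed

lemma decidable_le:
  assumes "computable f" and "computable g"
  shows "decidable (\<lambda>e. f e \<le> g e)"
proof -
  have "computable (\<lambda>e. 1 - (f e - g e))"
    by (intro computable_diff computable_const assms)
  moreover have "(\<lambda>e. 1 - (f e - g e)) = (\<lambda>e. of_bool (f e \<le> g e))" by auto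
  ultimately show ?thesis unfolding decidable_def by simp
qed

lemma decidable_less:
  assumes "computable f" and "computable g"
  shows "decidable (\<lambda>e. f e < g e)"
  using decidable_not[OF decidable_le[OF assms(2,1)]] by (simp only: not_le)

lemma decidable_eq:
  assumes "computable f" and "computable g"
  shows "decidable (\<lambda>e. f e = g e)"
  using decidable_conj[OF decidable_le[OF assms] decidable_le[OF assms(2,1)]]
  by (simp only: eq_iff)

text \<open>The bounded search is a primitive recursion whose accumulator records whether a witness
  has occurred.\<close>

lemma decidable_bex:
  assumes "decidable (\<lambda>e. P (e 0) (\<lambda>i. e (Suc i)))" and "computable b"
  shows "decidable (\<lambda>e. \<exists>y<b e. P y e)"
proof -
  have eq: "rec_nat 0 (\<lambda>a r. if P a e then 1 else r) n = (of_bool (\<exists>y<n. P y e) :: nat)" for n e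
    by (induction n) (auto simp: less_Suc_eq)
  obtain p k where "computes p k (\<lambda>e. of_bool (P (e 0) (\<lambda>i. e (Suc i))))"
    using assms(1) unfolding decidable_def computable_def by blast
  note p = computesD[OF this]
  \<comment> \<open>In the recursion step, entry 1 is the accumulator; the program for
    \<open>P\<close> is rerouted past it.\<close>
  have "decidable (\<lambda>e. P (e 0) (\<lambda>i. e (Suc (Suc i))))"
    unfolding decidable_def
  proof (rule computableI[where p = "Comp p (Proj 0 # map Proj [2..<2 + k])" and k = "k + 2"])
    fix m and e :: "nat \<Rightarrow> nat" assume m: "k + 2 \<le> m"
    let ?e = "case_nat (e 0) (\<lambda>i. e (Suc (Suc i)))"
    have "map (\<lambda>p. run p (map e [0..<m])) (Proj 0 # map Proj [2..<2 + k])
        = map (\<lambda>i. Some (?e i)) [0..<Suc k]"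
      using m by (intro nth_equalityI) (auto simp: nth_Cons split: nat.split simp del: upt_Suc)
    then show "run (Comp p (Proj 0 # map Proj [2..<2 + k])) (map e [0..<m])
        = Some (of_bool (P (e 0) (\<lambda>i. e (Suc (Suc i)))))"
      unfolding run_Comp by (simp only: those_map_Some) (simp add: p[of "Suc k" ?e] del: upt_Suc)
  qed
  then have "computable (\<lambda>e. rec_nat 0 (\<lambda>a r. if P a e then 1 else r) (b e))"
    by (intro computable_rec_nat computable_if computable_var computable_const assms(2))
  then show ?thesis unfolding decidable_def by (simp only: eq)
qed

lemma decidable_ball:
  assumes "decidable (\<lambda>e. P (e 0) (\<lambda>i. e (Suc i)))" and "computable b"
  shows "decidable (\<lambda>e. \<forall>y<b e. P y e)"
  using decidable_not[OF decidable_bex[of "\<lambda>y e. \<not> P y e", OF decidable_not[OF assms(1)] assms(2)]]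
  by simp

lemma decidable_finite_ball:
  assumes "finite A" and "\<And>x. x \<in> A \<Longrightarrow> decidable (P x)"
  shows "decidable (\<lambda>e. \<forall>x\<in>A. P x e)"
  using assms by (induction A) (auto intro: decidable_const decidable_conj)

lemma decidable_finite_bex:
  assumes "finite A" and "\<And>x. x \<in> A \<Longrightarrow> decidable (P x)"
  shows "decidable (\<lambda>e. \<exists>x\<in>A. P x e)"
  using assms by (induction A) (auto intro: decidable_const decidable_disj)

lemma computable_finite_sum:
  assumes "finite A" and "\<And>x. x \<in> A \<Longrightarrow> computable (f x)"
  shows "computable (\<lambda>e. \<Sum>x\<in>A. f x e)"
  using assms by (induction A) (auto intro: computable_const computable_add)

section \<open>Unbounded search\<close>

lemma run_Mu:
  assumes "\<And>n. run p (n # xs) = Some (of_bool (\<not> P n))" and "\<exists>n. P n"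
  shows "run (Mu p) xs = Some (LEAST n. P n)"
  using assms by simp

lemma computable_Least:
  assumes "decidable (\<lambda>e. P (e 0) (\<lambda>i. e (Suc i)))" and "\<And>e. \<exists>n. P n e"
  shows "computable (\<lambda>e. LEAST n. P n e)"
proof -
  \<comment> \<open>\<open>Mu\<close> looks for a zero, hence the negated predicate.\<close>
  obtain p k where "computes p k (\<lambda>e. of_bool (\<not> P (e 0) (\<lambda>i. e (Suc i))))"
    using decidable_not[OF assms(1)] unfolding decidable_def computable_def by blast
  note p = computesD[OF this]
  show ?thesis
  proof (rule computableI[where p = "Mu p" and k = k], rule run_Mu)
    fix m n and e :: "nat \<Rightarrow> nat" assume "k \<le> m"
    then show "run p (n # map e [0..<m]) = Some (of_bool (\<not> P n e))"
      using p[of "Suc m" "case_nat n e"] unfolding Cons_map_upt by simp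
  qed (rule assms(2))
qed

text \<open>The search for \<open>y\<close> is guaranteed to halt only if \<open>x\<close> satisfies
  the invariant, so the step cannot be treated as a total computable function. Instead
  \<open>Mu\<close> is placed directly inside a primitive recursion, which calls it only at the
  states \<open>\<sigma> n\<close>.\<close>

lemma computable_iterate:
  assumes "decidable (\<lambda>e. P (e 1) (e 2) (e 0))"
    and "I 0 s" and ex: "\<And>n x. I n x \<Longrightarrow> \<exists>y. P n x y"
    and inv: "\<And>n x y. I n x \<Longrightarrow> P n x y \<Longrightarrow> I (Suc n) y"
  shows "\<exists>\<sigma>. computable (\<lambda>e. \<sigma> (e 0)) \<and> \<sigma> 0 = s \<and> (\<forall>n. I n (\<sigma> n) \<and> P n (\<sigma> n) (\<sigma> (Suc n)))"
proof -
  define \<sigma> where "\<sigma> = rec_nat s (\<lambda>n x. LEAST y. P n x y)"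
  have \<sigma>_simps: "\<sigma> 0 = s" "\<sigma> (Suc n) = (LEAST y. P n (\<sigma> n) y)" for n
    by (auto simp: \<sigma>_def)
  have I: "I n (\<sigma> n)" for n
  proof (induction n)
    case 0
    show ?case by (simp add: \<sigma>_simps assms(2))
  next
    case (Suc n)
    show ?case unfolding \<sigma>_simps by (rule inv[OF Suc LeastI_ex[OF ex[OF Suc]]])
  qed
  have P: "P n (\<sigma> n) (\<sigma> (Suc n))" for n
    unfolding \<sigma>_simps by (rule LeastI_ex[OF ex[OF I]])
  obtain p k where "computes p k (\<lambda>e. of_bool (\<not> P (e 1) (e 2) (e 0)))"
    using decidable_not[OF assms(1)] unfolding decidable_def computable_def by blast
  note p = computesD[OF this]
  obtain q l where "computes q l (\<lambda>e. s)"
    using computable_const[of s] unfolding computable_def by auto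
  note q = computesD[OF this]
  have "computable (\<lambda>e. \<sigma> (e 0))"
  proof (rule computableI[where p = "PrimRec q (Mu p)" and k = "Suc (k + l)"])
    fix m and e :: "nat \<Rightarrow> nat" assume m: "Suc (k + l) \<le> m"
    define ys where "ys = map (\<lambda>i. e (Suc i)) [0..<m - 1]"
    have ys: "map e [0..<m] = e 0 # ys"
      using m unfolding ys_def by (intro nth_equalityI) (auto simp: nth_Cons split: nat.split)
    have step: "run (Mu p) (n # \<sigma> n # ys) = Some (\<sigma> (Suc n))" for n
      unfolding \<sigma>_simps
    proof (rule run_Mu)
      fix y
      have "k \<le> Suc (Suc (Suc (m - 1)))" using m by simp
      from p[OF this, of "case_nat y (case_nat n (case_nat (\<sigma> n) (\<lambda>i. e (Suc i))))"]
      show "run p (y # n # \<sigma> n # ys) = Some (of_bool (\<not> P n (\<sigma> n) y))"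
        unfolding ys_def Cons_map_upt by (simp add: numeral_2_eq_2)
    qed (rule ex[OF I])
    have "run (PrimRec q (Mu p)) (n # ys) = Some (\<sigma> n)" for n
    proof (induction n)
      case 0
      show ?case using q[of "m - 1"] m by (simp add: ys_def \<sigma>_simps)
    next
      case (Suc n)
      have "run (PrimRec q (Mu p)) (Suc n # ys)
          = Option.bind (run (PrimRec q (Mu p)) (n # ys)) (\<lambda>v. run (Mu p) (n # v # ys))"
        by (simp del: run.simps(6))
      then show ?case by (simp only: Suc bind.bind_lunit step)
    qed
    then show "run (PrimRec q (Mu p)) (map e [0..<m]) = Some (\<sigma> (e 0))"
      unfolding ys .
  qed
  then show ?thesis using I P \<sigma>_simps(1) by blast
qed

section \<open>Computable sets and transformations of the natural numbers\<close>

lemma decidable_set_iff: "decidable (\<lambda>e. e 0 \<in> A) \<longleftrightarrow> computable_set A"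
proof
  assume "decidable (\<lambda>e. e 0 \<in> A)"
  then obtain p k where "computes p k (\<lambda>e. of_bool (e 0 \<in> A))"
    unfolding decidable_def computable_def by blast
  note p = computesD[OF this]
  \<comment> \<open>\<open>p\<close> may demand \<open>k\<close> arguments while there is a single
    input; copies of it fill the list, as only entry 0 is tested.\<close>
  have "run (Comp p (replicate k (Proj 0))) [x] = Some (if x \<in> A then 1 else 0)" for x
  proof -
    have "map (\<lambda>q. run q [x]) (replicate k (Proj 0)) = map (\<lambda>i. Some x) [0..<k]"
      by (simp add: map_replicate_const)
    then show ?thesis
      unfolding run_Comp by (simp only: those_map_Some) (simp add: p)
  qed
  then show "computable_set A"
    unfolding computable_set_def partial_computable_def by blast
next
  assume "computable_set A"
  then obtain p where p: "\<And>x. run p [x] = Some (if x \<in> A then 1 else 0)"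
    unfolding computable_set_def partial_computable_def by blast
  show "decidable (\<lambda>e. e 0 \<in> A)"
    unfolding decidable_def
    by (rule computableI[where p = "Comp p [Proj 0]" and k = 1]) (auto simp: p)
qed

text \<open>A program for \<open>\<rho>\<close> may diverge outside \<open>dom \<rho>\<close>, so it has to be called lazily: it is the
  step function of a primitive recursion whose recursion argument is the characteristic function
  of \<open>dom \<rho>\<close>.\<close>

lemma computable_the_partial:
  assumes "partial_computable \<rho>" and "computable_set (dom \<rho>)"
  shows "computable (\<lambda>e. case \<rho> (e 0) of None \<Rightarrow> 0 | Some y \<Rightarrow> y)"
proof -
  obtain p where p: "\<And>x. run p [x] = \<rho> x"
    using assms(1) unfolding partial_computable_def by blast
  obtain q where q: "\<And>x. run q [x] = Some (if x \<in> dom \<rho> then 1 else 0)"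
    using assms(2) unfolding computable_set_def partial_computable_def by blast
  \<comment> \<open>For recursion argument 0 the result is the default 0; for 1 the step runs once,
    on counter, accumulator and \<open>x\<close>, whence \<open>Proj 2\<close>.\<close>
  show ?thesis
    by (rule computableI[where k = 1 and
          p = "Comp (PrimRec Zero (Comp p [Proj 2])) [Comp q [Proj 0], Proj 0]"])
      (auto simp: p q domIff split: option.splits)
qed

lemma decidable_graph:
  assumes "computable_trans \<rho>" and "computable f" and "computable g"
  shows "decidable (\<lambda>e. \<rho> (f e) = Some (g e))"
proof -
  let ?h = "\<lambda>x. case \<rho> x of None \<Rightarrow> 0 | Some y \<Rightarrow> y"
  have h: "computable (\<lambda>e. ?h (f e))"
    using assms(1) unfolding computable_trans_def
    by (intro computable_comp1[of ?h, OF _ assms(2)] computable_the_partial) auto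
  have "decidable (\<lambda>e. e 0 \<in> dom \<rho>)"
    using assms(1) unfolding computable_trans_def decidable_set_iff by blast
  then have "decidable (\<lambda>e. f e \<in> dom \<rho>)"
    by (rule decidable_comp1[OF _ assms(2)])
  \<comment> \<open>Outside \<open>dom \<rho>\<close> the default value 0 of \<open>?h\<close> might
    equal \<open>g e\<close>, so the domain is tested as well.\<close>
  then have "decidable (\<lambda>e. f e \<in> dom \<rho> \<and> ?h (f e) = g e)"
    by (rule decidable_conj[OF _ decidable_eq[OF h assms(3)]])
  moreover have "(f e \<in> dom \<rho> \<and> ?h (f e) = g e) = (\<rho> (f e) = Some (g e))" for e
    by (auto split: option.splits)
  ultimately show ?thesis by simp
qed

lemmas computable_intros =
  computable_const computable_var computable_Suc computable_add computable_mult computable_pow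
  computable_diff computable_if decidable_const decidable_not decidable_conj decidable_disj
  decidable_imp decidable_iff decidable_le decidable_less decidable_eq decidable_bex decidable_ball

section \<open>Matchings\<close>

text \<open>The Halmos-Vaughan induction on \<open>card I\<close>: either some proper non-empty
  subset is tight and the problem splits there, or every such subset has a spare neighbour and one
  pair may be fixed arbitrarily.\<close>

theorem Hall:
  assumes "finite I" and "\<And>i. i \<in> I \<Longrightarrow> finite (N i)"
    and "\<And>J. J \<subseteq> I \<Longrightarrow> card J \<le> card (\<Union>(N ` J))"
  shows "\<exists>f. inj_on f I \<and> (\<forall>i\<in>I. f i \<in> N i)"
  using assms
proof (induction "card I" arbitrary: I N rule: less_induct)
  case less
  note fin = less.prems(1,2) and hall = less.prems(3)
  have finU: "finite (\<Union>(N ` J))" if "J \<subseteq> I" for J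
    using that fin by (meson finite_UN_I finite_subset subsetD)
  consider "I = {}"
    | J where "J \<subset> I" "J \<noteq> {}" "card (\<Union>(N ` J)) = card J"
    | i where "i \<in> I" "\<And>J. J \<subset> I \<Longrightarrow> J \<noteq> {} \<Longrightarrow> card J < card (\<Union>(N ` J))"
    using hall by (metis equals0I le_neq_implies_less psubset_imp_subset)
  then show ?case
  proof cases
    case 1
    then show ?thesis by simp
  next
    case (2 J)
    let ?N = "\<lambda>i. N i - \<Union>(N ` J)"
    have J: "finite J" "J \<subseteq> I" using 2(1) fin(1) finite_subset by auto
    have "\<exists>f. inj_on f J \<and> (\<forall>i\<in>J. f i \<in> N i)"
    proof (rule less.hyps)
      show "card J < card I" using 2(1) fin(1) by (rule psubset_card_mono[rotated])
      show "card K \<le> card (\<Union>(N ` K))" if "K \<subseteq> J" for K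
        using hall that J(2) by blast
    qed (use J fin in auto)
    then obtain f where f: "inj_on f J" "\<And>i. i \<in> J \<Longrightarrow> f i \<in> N i" by blast
    have "\<exists>g. inj_on g (I - J) \<and> (\<forall>i\<in>I - J. g i \<in> ?N i)"
    proof (rule less.hyps)
      have "I - J \<subset> I" using 2(1,2) by blast
      then show "card (I - J) < card I" by (rule psubset_card_mono[OF fin(1)])
      \<comment> \<open>Hall's condition is applied to \<open>K \<union> J\<close>; since
        \<open>J\<close> is tight, its contribution cancels on both sides.\<close>
      fix K assume K: "K \<subseteq> I - J"
      have "card (K \<union> J) = card K + card J"
        using K J fin(1) by (intro card_Un_disjoint) (auto intro: finite_subset)
      moreover have "card (K \<union> J) \<le> card (\<Union>(N ` (K \<union> J)))"
        using K J by (intro hall) auto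
      moreover have "\<Union>(N ` (K \<union> J)) = \<Union>(?N ` K) \<union> \<Union>(N ` J)" by auto
      moreover have "card (\<Union>(?N ` K) \<union> \<Union>(N ` J)) \<le> card (\<Union>(?N ` K)) + card (\<Union>(N ` J))"
        by (rule card_Un_le)
      ultimately show "card K \<le> card (\<Union>(?N ` K))" using 2(3) by simp
    qed (use fin in auto)
    then obtain g where g: "inj_on g (I - J)" "\<And>i. i \<in> I - J \<Longrightarrow> g i \<in> ?N i" by blast
    define h where "h i = (if i \<in> J then f i else g i)" for i
    have "inj_on h (J \<union> (I - J))"
    proof (subst inj_on_Un, intro conjI)
      show "inj_on h J" using f(1) by (simp add: h_def inj_on_def)
      show "inj_on h (I - J)" using g(1) by (simp add: h_def inj_on_def)
      show "h ` (J - (I - J)) \<inter> h ` (I - J - J) = {}"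
        using f(2) g(2) by (fastforce simp: h_def)
    qed
    moreover have "J \<union> (I - J) = I" using J(2) by blast
    moreover have "h i \<in> N i" if "i \<in> I" for i
      using f(2) g(2) that by (auto simp: h_def)
    ultimately show ?thesis by metis
  next
    case (3 i)
    have "card {i} \<le> card (\<Union>(N ` {i}))" using 3(1) by (intro hall) auto
    then have "N i \<noteq> {}" by auto
    then obtain x where x: "x \<in> N i" by blast
    let ?N = "\<lambda>j. N j - {x}"
    have "\<exists>f. inj_on f (I - {i}) \<and> (\<forall>j\<in>I - {i}. f j \<in> ?N j)"
    proof (rule less.hyps)
      show "card (I - {i}) < card I" using 3(1) fin(1) by (rule card_Diff1_less[rotated])
      fix J assume J: "J \<subseteq> I - {i}"
      show "card J \<le> card (\<Union>(?N ` J))"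
      proof (cases "J = {}")
        case False
        \<comment> \<open>The strict inequality pays for the loss of \<open>x\<close>.\<close>
        then have "card J < card (\<Union>(N ` J))" using J 3 by blast
        moreover have "\<Union>(?N ` J) = \<Union>(N ` J) - {x}" by auto
        ultimately show ?thesis using card_Diff1_le[of "\<Union>(N ` J)" x]
            card_Diff_singleton_if[of "\<Union>(N ` J)" x] by auto
      qed simp
    qed (use fin in auto)
    then obtain f where f: "inj_on f (I - {i})" "\<And>j. j \<in> I - {i} \<Longrightarrow> f j \<in> ?N j" by blast
    have "inj_on (f(i := x)) I"
      using f by (auto simp: inj_on_def)
    moreover have "\<forall>j\<in>I. (f(i := x)) j \<in> N j" using f(2) x by auto
    ultimately show ?thesis by blast
  qed
qed

definition matching :: "('a \<times> 'b) set \<Rightarrow> bool" where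
  "matching M \<longleftrightarrow> (\<forall>u v u' v'. (u, v) \<in> M \<longrightarrow> (u', v') \<in> M \<longrightarrow> (u = u' \<longleftrightarrow> v = v'))"

lemma matching_empty: "matching {}"
  by (simp add: matching_def)

lemma matching_subset: "matching M \<Longrightarrow> M' \<subseteq> M \<Longrightarrow> matching M'"
  unfolding matching_def by blast

lemma matching_converse: "matching M \<Longrightarrow> matching (M\<inverse>)"
  unfolding matching_def by blast

lemma matching_Un:
  assumes "matching M" and "matching M'" and "Domain M \<inter> Domain M' = {}" and "Range M \<inter> Range M' = {}"
  shows "matching (M \<union> M')"
proof -
  have "u \<noteq> u' \<and> v \<noteq> v'" if "(u, v) \<in> M" "(u', v') \<in> M'" for u v u' v'
    using assms(3,4) that by blast
  with assms(1,2) show ?thesis unfolding matching_def Un_iff by metis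
qed

lemma card_matching_Image:
  assumes "matching M" and "A \<subseteq> Domain M"
  shows "card (M `` A) = card A"
proof -
  have "\<forall>a\<in>A. \<exists>v. (a, v) \<in> M" using assms(2) by auto
  then obtain f where f: "\<And>a. a \<in> A \<Longrightarrow> (a, f a) \<in> M" by metis
  have "inj_on f A" using f assms(1) unfolding matching_def inj_on_def by metis
  moreover have "M `` A = f ` A"
    using f assms(1) unfolding matching_def by blast
  ultimately show ?thesis by (simp add: card_image)
qed

text \<open>The two injections are combined as in Banach's proof of the Cantor--Bernstein theorem.\<close>

lemma Mendelsohn_Dulmage:
  assumes "inj_on f U" and "inj_on g V"
  obtains M where "matching M" and "U \<subseteq> Domain M" and "V \<subseteq> Range M"
    and "M \<subseteq> (\<lambda>u. (u, f u)) ` U \<union> (\<lambda>v. (g v, v)) ` V"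
proof -
  \<comment> \<open>\<open>W\<close> is the set of left vertices matched along \<open>f\<close>. By
    the fixed point equation, the elements of \<open>U\<close> outside \<open>W\<close> are those
    reached by \<open>g\<close> from the right vertices that \<open>f\<close> leaves free.\<close>
  define W where "W = lfp (\<lambda>W. U - g ` (V - f ` W))"
  have "mono (\<lambda>W. U - g ` (V - f ` W))" by (intro monoI Diff_mono image_mono order_refl)
  then have W: "W = U - g ` (V - f ` W)" unfolding W_def by (rule lfp_unfold)
  define M where "M = (\<lambda>u. (u, f u)) ` W \<union> (\<lambda>v. (g v, v)) ` (V - f ` W)"
  have WU: "W \<subseteq> U" using W by blast
  have "matching M"
    unfolding M_def
  proof (rule matching_Un)
    show "matching ((\<lambda>u. (u, f u)) ` W)"
      using WU assms(1) unfolding matching_def inj_on_def by blast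
    show "matching ((\<lambda>v. (g v, v)) ` (V - f ` W))"
      using assms(2) unfolding matching_def inj_on_def by blast
    have "W \<inter> g ` (V - f ` W) = {}" using W by blast
    then show "Domain ((\<lambda>u. (u, f u)) ` W) \<inter> Domain ((\<lambda>v. (g v, v)) ` (V - f ` W)) = {}"
      by auto
    show "Range ((\<lambda>u. (u, f u)) ` W) \<inter> Range ((\<lambda>v. (g v, v)) ` (V - f ` W)) = {}"
      by auto
  qed
  moreover have "U \<subseteq> Domain M"
  proof
    fix u assume "u \<in> U"
    then have "u \<in> W \<or> u \<in> g ` (V - f ` W)" using W by blast
    then show "u \<in> Domain M" by (auto simp: M_def)
  qed
  moreover have "V \<subseteq> Range M" unfolding M_def Range_Un_eq by force
  moreover have "M \<subseteq> (\<lambda>u. (u, f u)) ` U \<union> (\<lambda>v. (g v, v)) ` V"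
    using WU by (auto simp: M_def)
  ultimately show thesis by (rule that)
qed

section \<open>Extendable finite matchings\<close>

definition covers_upto :: "(nat \<times> nat) set \<Rightarrow> nat \<Rightarrow> bool" where
  "covers_upto M n \<longleftrightarrow> {..n} \<subseteq> Domain M \<and> {..n} \<subseteq> Range M"

text \<open>For finite \<open>M\<close> and locally finite \<open>E\<close> this amounts, by
  compactness, to \<open>M\<close> lying in a perfect matching; the form chosen speaks of finite
  matchings only.\<close>

definition extendable :: "(nat \<times> nat) set \<Rightarrow> (nat \<times> nat) set \<Rightarrow> bool" where
  "extendable E M \<longleftrightarrow>
     (\<forall>n. \<exists>M'. finite M' \<and> matching M' \<and> M \<subseteq> M' \<and> M' \<subseteq> E \<and> covers_upto M' n)"

text \<open>Hall's theorem on each side matches the part of the initial segment outside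
  \<open>M\<close>; \<open>Mendelsohn_Dulmage\<close> merges the two injections into one matching,
  which avoids the vertices of \<open>M\<close> and is joined to it.\<close>

lemma extendableI:
  assumes M: "finite M" "matching M" "M \<subseteq> E"
    and fin: "\<And>u. finite (E `` {u})" "\<And>v. finite (E\<inverse> `` {v})"
    and hall: "\<And>A. finite A \<Longrightarrow> A \<inter> Domain M = {} \<Longrightarrow> card A \<le> card (E `` A - Range M)"
      "\<And>A. finite A \<Longrightarrow> A \<inter> Range M = {} \<Longrightarrow> card A \<le> card (E\<inverse> `` A - Domain M)"
  shows "extendable E M"
  unfolding extendable_def
proof
  fix n
  let ?U = "{..n} - Domain M" and ?V = "{..n} - Range M"
  have "\<exists>f. inj_on f ?U \<and> (\<forall>u\<in>?U. f u \<in> E `` {u} - Range M)"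
  proof (rule Hall)
    fix J assume "J \<subseteq> ?U"
    then have "card J \<le> card (E `` J - Range M)"
      by (intro hall) (auto intro: finite_subset)
    also have "E `` J - Range M = (\<Union>u\<in>J. E `` {u} - Range M)" by auto
    finally show "card J \<le> card (\<Union>u\<in>J. E `` {u} - Range M)" .
  qed (use fin in auto)
  then obtain f where f: "inj_on f ?U" "\<And>u. u \<in> ?U \<Longrightarrow> (u, f u) \<in> E \<and> f u \<notin> Range M"
    by blast
  have "\<exists>g. inj_on g ?V \<and> (\<forall>v\<in>?V. g v \<in> E\<inverse> `` {v} - Domain M)"
  proof (rule Hall)
    fix J assume "J \<subseteq> ?V"
    then have "card J \<le> card (E\<inverse> `` J - Domain M)"
      by (intro hall) (auto intro: finite_subset)
    also have "E\<inverse> `` J - Domain M = (\<Union>v\<in>J. E\<inverse> `` {v} - Domain M)" by auto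
    finally show "card J \<le> card (\<Union>v\<in>J. E\<inverse> `` {v} - Domain M)" .
  qed (use fin in auto)
  then obtain g where g: "inj_on g ?V" "\<And>v. v \<in> ?V \<Longrightarrow> (g v, v) \<in> E \<and> g v \<notin> Domain M"
    by blast
  obtain M' where M': "matching M'" "?U \<subseteq> Domain M'" "?V \<subseteq> Range M'"
    "M' \<subseteq> (\<lambda>u. (u, f u)) ` ?U \<union> (\<lambda>v. (g v, v)) ` ?V"
    using Mendelsohn_Dulmage[OF f(1) g(1)] .
  have "finite M'" using M'(4) by (rule finite_subset) auto
  moreover have "M' \<subseteq> E" using M'(4) f(2) g(2) by blast
  moreover have "Domain M \<inter> Domain M' = {}" "Range M \<inter> Range M' = {}"
    using M'(4) f(2) g(2) by fastforce+
  moreover have "covers_upto (M \<union> M') n"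
    using M'(2,3) unfolding covers_upto_def by auto
  ultimately show "\<exists>M'. finite M' \<and> matching M' \<and> M \<subseteq> M' \<and> M' \<subseteq> E \<and> covers_upto M' n"
    using M M'(1) by (intro exI[of _ "M \<union> M'"]) (auto intro: matching_Un)
qed

section \<open>Hall's condition after removal of a finite matching\<close>

text \<open>Local finiteness with an explicit bound, later a computable one. The clause
  \<open>n \<le> \<beta> n\<close> makes the iterates of \<open>\<beta>\<close>
  non-decreasing.\<close>

definition locally_bounded :: "(nat \<times> nat) set \<Rightarrow> (nat \<Rightarrow> nat) \<Rightarrow> bool" where
  "locally_bounded E \<beta> \<longleftrightarrow> (\<forall>n. n \<le> \<beta> n) \<and>
     (\<forall>u v n. (u, v) \<in> E \<longrightarrow> (u \<le> n \<longrightarrow> v \<le> \<beta> n) \<and> (v \<le> n \<longrightarrow> u \<le> \<beta> n))"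

lemma locally_boundedD:
  assumes "locally_bounded E \<beta>"
  shows "(u, v) \<in> E \<Longrightarrow> u \<le> n \<Longrightarrow> v \<le> \<beta> n"
    and "(u, v) \<in> E \<Longrightarrow> v \<le> n \<Longrightarrow> u \<le> \<beta> n" and "n \<le> \<beta> n"
  using assms unfolding locally_bounded_def by blast+

lemma locally_bounded_converse: "locally_bounded E \<beta> \<Longrightarrow> locally_bounded (E\<inverse>) \<beta>"
  unfolding locally_bounded_def by blast

lemma finite_Image_locally_bounded:
  assumes "locally_bounded E \<beta>" and "finite A"
  shows "finite (E `` A)"
proof (rule finite_subset)
  show "E `` A \<subseteq> (\<Union>u\<in>A. {..\<beta> u})"
    using locally_boundedD(1)[OF assms(1)] by fastforce
qed (use assms(2) in auto)

definition doubling :: "('a \<times> 'b) set \<Rightarrow> bool" where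
  "doubling E \<longleftrightarrow> (\<forall>A. finite A \<longrightarrow> 2 * card A \<le> card (E `` A))"

text \<open>A set \<open>A\<close> with at least \<open>z\<close> elements gains more from the expansion than it loses to \<open>M\<close>.
  A smaller one misses one of the \<open>z\<close> layers \<open>{(\<beta> ^^ (2 * i)) z <.. (\<beta> ^^ (2 * i + 2)) z}\<close>, hence splits into a part
  covered by \<open>M'\<close> and a part far away from \<open>M\<close>, with disjoint neighbourhoods.\<close>

lemma hall_residual:
  assumes lb: "locally_bounded E \<beta>" and "doubling E"
    and M: "Range M \<subseteq> {..z}" "card (Range M) \<le> z"
    and M': "matching M'" "M \<subseteq> M'" "M' \<subseteq> E" "{..(\<beta> ^^ (2 * z)) z} \<subseteq> Domain M'"
    and A: "finite A" "A \<inter> Domain M = {}"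
  shows "card A \<le> card (E `` A - Range M)"
proof -
  note bound = locally_boundedD[OF lb]
  have expand: "2 * card B \<le> card (E `` B)" if "finite B" for B
    using \<open>doubling E\<close> that unfolding doubling_def by blast
  have fin: "finite (E `` B)" if "finite B" for B
    using finite_Image_locally_bounded[OF lb that] .
  define t where "t i = (\<beta> ^^ i) z" for i
  have t_Suc: "t (Suc i) = \<beta> (t i)" for i by (simp add: t_def)
  have t_mono: "t i \<le> t j" if "i \<le> j" for i j
    using that by (rule lift_Suc_mono_le[of t, rotated]) (simp add: t_Suc bound(3))
  have t_0: "t 0 = z" by (simp add: t_def)
  \<comment> \<open>If every layer met \<open>A\<close>, one element from each would give
    \<open>z\<close> distinct elements.\<close>
  consider "z \<le> card A" | i where "i < z" "\<And>a. a \<in> A \<Longrightarrow> a \<le> t (2 * i) \<or> t (2 * i + 2) < a"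
  proof (rule ccontr)
    assume "\<not> thesis"
    with that have lt: "\<not> z \<le> card A"
      and "\<forall>i<z. \<exists>a\<in>A. t (2 * i) < a \<and> a \<le> t (2 * i + 2)"
      by (blast, metis linorder_not_le)
    then obtain a where a: "\<And>i. i < z \<Longrightarrow> a i \<in> A \<and> t (2 * i) < a i \<and> a i \<le> t (2 * i + 2)"
      by metis
    have "a i < a j" if "i < j" "j < z" for i j
      using a[of i] a[of j] that t_mono[of "2 * i + 2" "2 * j"] by linarith
    then have "inj_on a {..<z}"
      by (metis inj_onI lessThan_iff linorder_neq_iff)
    then have "card {..<z} \<le> card A"
      using A(1) a by (intro card_inj_on_le[of a]) auto
    with lt show False by simp
  qed
  then show ?thesis
  proof cases
    case 1
    \<comment> \<open>Doubling gains \<open>card A \<ge> z\<close> vertices, at least as many as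
      \<open>Range M\<close> removes.\<close>
    have "card (E `` A) - card (Range M) \<le> card (E `` A - Range M)"
      by (rule diff_card_le_card_Diff) (use M(1) finite_subset in auto)
    then show ?thesis using expand[OF A(1)] M(2) 1 by linarith
  next
    case (2 i)
    define B where "B = {a \<in> A. a \<le> t (2 * i)}"
    define C where "C = {a \<in> A. t (2 * i + 2) < a}"
    have BC: "A = B \<union> C" "finite B" "finite C" using 2(2) A(1) by (auto simp: B_def C_def)
    have B: "B \<subseteq> Domain M'"
      using M'(4) t_mono[of "2 * i" "2 * z"] 2(1) by (fastforce simp: B_def t_def)
    \<comment> \<open>If \<open>M\<close> already used the \<open>M'\<close>-partner of a vertex of
      \<open>B\<close>, then, \<open>M'\<close> being a matching, that vertex of \<open>A\<close>
      would lie in \<open>Domain M\<close>.\<close>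
    have MB: "M' `` B \<subseteq> E `` A - Range M"
    proof
      fix v assume "v \<in> M' `` B"
      then obtain u where u: "u \<in> B" "(u, v) \<in> M'" by blast
      have "v \<notin> Range M"
      proof
        assume "v \<in> Range M"
        then obtain w where "(w, v) \<in> M" by blast
        then have "w = u" using u M'(1,2) unfolding matching_def by blast
        then show False using \<open>(w, v) \<in> M\<close> u(1) A(2) BC(1) by blast
      qed
      then show "v \<in> E `` A - Range M" using u M'(3) BC(1) by blast
    qed
    \<comment> \<open>The empty layer is two applications of \<open>\<beta>\<close> wide: one bounds
      the neighbours of \<open>B\<close> from above, the other those of \<open>C\<close> from
      below.\<close>
    have le: "v \<le> t (2 * i + 1)" if "v \<in> M' `` B" for v
      using that M'(3) bound(1) unfolding B_def by (fastforce simp: t_Suc)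
    have gt: "t (2 * i + 1) < v" if "v \<in> E `` C" for v
    proof (rule ccontr)
      assume "\<not> ?thesis"
      then show False using that bound(2)[of _ v "t (2 * i + 1)"] unfolding C_def
        by (fastforce simp: t_Suc)
    qed
    have EC: "E `` C \<subseteq> E `` A - Range M"
    proof
      fix v assume v: "v \<in> E `` C"
      then have "z < v" using gt t_mono[of 0 "2 * i + 1"] t_0 by fastforce
      then have "v \<notin> Range M" using M(1) by auto
      then show "v \<in> E `` A - Range M" using v BC(1) by blast
    qed
    have "card A \<le> card B + card C" using BC(1) card_Un_le by metis
    also have "\<dots> \<le> card (M' `` B) + card (E `` C)"
      using card_matching_Image[OF M'(1) B] expand[OF BC(3)] by simp
    also have "\<dots> = card (M' `` B \<union> E `` C)"
    proof (rule card_Un_disjoint[symmetric])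
      show "finite (M' `` B)" using M'(3) fin[OF BC(2)] by (meson Image_mono finite_subset subset_refl)
      show "M' `` B \<inter> E `` C = {}" using le gt by fastforce
    qed (rule fin[OF BC(3)])
    also have "\<dots> \<le> card (E `` A - Range M)"
      using MB EC fin[OF A(1)] by (intro card_mono) auto
    finally show ?thesis .
  qed
qed

section \<open>Computable perfect matchings\<close>

text \<open>The binary digits of \<open>z\<close> mark codes of pairs, so every number codes a
  finite relation and a search over numbers meets all of them.\<close>

definition coded_rel :: "nat \<Rightarrow> (nat \<times> nat) set" where
  "coded_rel z = prod_encode -` set_decode z"

lemma coded_rel_surj:
  assumes "finite M"
  shows "coded_rel (set_encode (prod_encode ` M)) = M"
  using assms inj_prod_encode[of UNIV] unfolding coded_rel_def
  by (simp add: inj_vimage_image_eq)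

text \<open>A digit 1 at position \<open>p\<close> forces \<open>2 ^ p \<le> z\<close>, hence
  \<open>p < z\<close>. Quantifiers over vertices thus become bounded by the code, which makes
  properties of coded relations decidable.\<close>

lemma coded_rel_less:
  assumes "(u, v) \<in> coded_rel z"
  shows "u < z" and "v < z"
proof -
  have "prod_encode (u, v) \<in> set_decode z"
    using assms by (simp add: coded_rel_def)
  then have "odd (z div 2 ^ prod_encode (u, v))"
    by (simp add: set_decode_def)
  then have "z div 2 ^ prod_encode (u, v) \<noteq> 0" by (intro notI) simp
  then have "2 ^ prod_encode (u, v) \<le> z" by (metis div_less linorder_not_le)
  then have "prod_encode (u, v) < z" using less_exp[of "prod_encode (u, v)"] by linarith
  then show "u < z" and "v < z"
    using le_prod_encode_1[of u v] le_prod_encode_2[of v u] by linarith+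
qed

lemma Domain_coded_rel: "Domain (coded_rel z) \<subseteq> {..<z}"
  and Range_coded_rel: "Range (coded_rel z) \<subseteq> {..<z}"
  by (auto dest: coded_rel_less)

lemma finite_coded_rel: "finite (coded_rel z)"
  by (rule finite_subset[of _ "{..<z} \<times> {..<z}"]) (auto dest: coded_rel_less)

lemma computable_prod_encode:
  assumes "computable f" and "computable g"
  shows "computable (\<lambda>e. prod_encode (f e, g e))"
proof -
  have "triangle n = rec_nat 0 (\<lambda>k r. r + Suc k) n" for n
    by (induction n) auto
  then have eq: "prod_encode (a, b) = rec_nat 0 (\<lambda>k r. r + Suc k) (a + b) + a" for a b
    by (simp add: prod_encode_def)
  show ?thesis
    unfolding eq by (intro computable_rec_nat computable_intros assms)
qed

text \<open>The pairing is inverted by a search; the other component is at most the code, so its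
  quantifier is bounded.\<close>

lemma computable_fst_prod_decode:
  assumes "computable f"
  shows "computable (\<lambda>e. fst (prod_decode (f e)))"
proof -
  have eq: "(LEAST a. \<exists>b<Suc s. prod_encode (a, b) = s) = fst (prod_decode s)" for s
  proof (rule Least_equality)
    show "\<exists>b<Suc s. prod_encode (fst (prod_decode s), b) = s"
      using le_prod_encode_2[of "snd (prod_decode s)" "fst (prod_decode s)"]
      by (intro exI[of _ "snd (prod_decode s)"]) auto
  qed auto
  have "computable (\<lambda>e. LEAST a. \<exists>b<Suc (e 0). prod_encode (a, b) = e 0)"
  proof (rule computable_Least)
    show "decidable (\<lambda>e. \<exists>b<Suc (e (Suc 0)). prod_encode (e 0, b) = e (Suc 0))"
      by (intro computable_intros computable_prod_encode)
    show "\<exists>a. \<exists>b<Suc (e 0). prod_encode (a, b) = e 0" for e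
      using LeastI_ex le_prod_encode_2 by (metis le_imp_less_Suc prod_decode_inverse surj_pair)
  qed
  then show ?thesis unfolding eq by (rule computable_comp1[OF _ assms])
qed

lemma computable_snd_prod_decode:
  assumes "computable f"
  shows "computable (\<lambda>e. snd (prod_decode (f e)))"
proof -
  have eq: "(LEAST b. \<exists>a<Suc s. prod_encode (a, b) = s) = snd (prod_decode s)" for s
  proof (rule Least_equality)
    show "\<exists>a<Suc s. prod_encode (a, snd (prod_decode s)) = s"
      using le_prod_encode_1[of "fst (prod_decode s)" "snd (prod_decode s)"]
      by (intro exI[of _ "fst (prod_decode s)"]) auto
  qed auto
  have "computable (\<lambda>e. LEAST b. \<exists>a<Suc (e 0). prod_encode (a, b) = e 0)"
  proof (rule computable_Least)
    show "decidable (\<lambda>e. \<exists>a<Suc (e (Suc 0)). prod_encode (a, e 0) = e (Suc 0))"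
      by (intro computable_intros computable_prod_encode)
    show "\<exists>b. \<exists>a<Suc (e 0). prod_encode (a, b) = e 0" for e
      by (metis le_imp_less_Suc le_prod_encode_1 prod_decode_inverse surj_pair)
  qed
  then show ?thesis unfolding eq by (rule computable_comp1[OF _ assms])
qed

lemma decidable_coded_rel:
  assumes "computable f" and "computable g" and "computable h"
  shows "decidable (\<lambda>e. (f e, g e) \<in> coded_rel (h e))"
proof -
  \<comment> \<open>The digit test without division: the quotient by \<open>2 ^ x\<close> is
    \<open>2 * q + 1\<close> for some \<open>q \<le> z\<close>.\<close>
  have eq: "x \<in> set_decode z \<longleftrightarrow> (\<exists>q<Suc z. (2 * q + 1) * 2 ^ x \<le> z \<and> z < (2 * q + 2) * 2 ^ x)"
    (is "_ \<longleftrightarrow> ?R") for x z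
  proof -
    have div: "z div 2 ^ x = 2 * q + 1 \<longleftrightarrow> (2 * q + 1) * 2 ^ x \<le> z \<and> z < (2 * q + 2) * 2 ^ x" for q
    proof -
      have "(2 * q + 1) * 2 ^ x \<le> z \<longleftrightarrow> 2 * q + 1 \<le> z div 2 ^ x"
        by (simp add: less_eq_div_iff_mult_less_eq)
      moreover have "z < (2 * q + 2) * 2 ^ x \<longleftrightarrow> z div 2 ^ x < 2 * q + 2"
        by (simp add: div_less_iff_less_mult)
      ultimately show ?thesis by auto
    qed
    have "x \<in> set_decode z \<longleftrightarrow> (\<exists>q. z div 2 ^ x = 2 * q + 1)"
      by (auto simp: set_decode_def elim: oddE)
    also have "\<dots> \<longleftrightarrow> (\<exists>q<Suc z. z div 2 ^ x = 2 * q + 1)"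
    proof
      assume "\<exists>q. z div 2 ^ x = 2 * q + 1"
      then obtain q where q: "z div 2 ^ x = 2 * q + 1" ..
      then have "2 * q + 1 \<le> z" using div_le_dividend[of z "2 ^ x"] by linarith
      then show "\<exists>q<Suc z. z div 2 ^ x = 2 * q + 1" using q by (intro exI[of _ q]) auto
    qed auto
    finally show ?thesis unfolding div .
  qed
  have "decidable (\<lambda>e. \<exists>q<Suc (e 1). (2 * q + 1) * 2 ^ e 0 \<le> e 1 \<and> e 1 < (2 * q + 2) * 2 ^ e 0)"
    by (intro computable_intros)
  then have "decidable (\<lambda>e. e 0 \<in> set_decode (e 1))" unfolding eq .
  from decidable_comp2[OF this computable_prod_encode[OF assms(1,2)] assms(3)]
  show ?thesis by (simp add: coded_rel_def)
qed

lemma decidable_Domain_coded_rel: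
  assumes "computable f" and "computable g"
  shows "decidable (\<lambda>e. f e \<in> Domain (coded_rel (g e)))"
proof -
  have eq: "u \<in> Domain (coded_rel z) \<longleftrightarrow> (\<exists>v<z. (u, v) \<in> coded_rel z)" for u z
    by (auto dest: coded_rel_less)
  have "decidable (\<lambda>e. \<exists>v<e 1. (e 0, v) \<in> coded_rel (e 1))"
    by (intro computable_intros decidable_coded_rel)
  then show ?thesis unfolding eq[symmetric] by (rule decidable_comp2[OF _ assms])
qed

lemma decidable_Range_coded_rel:
  assumes "computable f" and "computable g"
  shows "decidable (\<lambda>e. f e \<in> Range (coded_rel (g e)))"
proof -
  have eq: "v \<in> Range (coded_rel z) \<longleftrightarrow> (\<exists>u<z. (u, v) \<in> coded_rel z)" for v z
    by (auto dest: coded_rel_less)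
  have "decidable (\<lambda>e. \<exists>u<e 1. (u, e 0) \<in> coded_rel (e 1))"
    by (intro computable_intros decidable_coded_rel)
  then show ?thesis unfolding eq[symmetric] by (rule decidable_comp2[OF _ assms])
qed

lemma coded_rel_subset_iff:
  "coded_rel z \<subseteq> S \<longleftrightarrow> (\<forall>u<z. \<forall>v<z. (u, v) \<in> coded_rel z \<longrightarrow> (u, v) \<in> S)"
  by (auto dest: coded_rel_less)

lemma decidable_coded_rel_subset:
  assumes "computable f" and "computable g"
  shows "decidable (\<lambda>e. coded_rel (f e) \<subseteq> coded_rel (g e))"
proof -
  have "decidable (\<lambda>e. \<forall>u<e 0. \<forall>v<e 0. (u, v) \<in> coded_rel (e 0) \<longrightarrow> (u, v) \<in> coded_rel (e 1))"
    by (intro computable_intros decidable_coded_rel)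
  then show ?thesis
    unfolding coded_rel_subset_iff[symmetric] by (rule decidable_comp2[OF _ assms])
qed

lemma decidable_coded_rel_subset':
  assumes "decidable (\<lambda>e. (e 0, e 1) \<in> E)" and "computable f"
  shows "decidable (\<lambda>e. coded_rel (f e) \<subseteq> E)"
proof -
  have "decidable (\<lambda>e. \<forall>u<e 0. \<forall>v<e 0. (u, v) \<in> coded_rel (e 0) \<longrightarrow> (u, v) \<in> E)"
    by (intro computable_intros decidable_coded_rel
        decidable_comp2[of "\<lambda>u v. (u, v) \<in> E", OF assms(1) computable_var computable_var])
  then show ?thesis
    unfolding coded_rel_subset_iff[symmetric] by (rule decidable_comp1[OF _ assms(2)])
qed

lemma decidable_matching_coded_rel:
  assumes "computable f"
  shows "decidable (\<lambda>e. matching (coded_rel (f e)))"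
proof -
  have eq: "matching (coded_rel z) \<longleftrightarrow> (\<forall>u<z. \<forall>v<z. \<forall>u'<z. \<forall>v'<z.
      (u, v) \<in> coded_rel z \<longrightarrow> (u', v') \<in> coded_rel z \<longrightarrow> (u = u' \<longleftrightarrow> v = v'))" for z
    unfolding matching_def by (metis coded_rel_less)
  have "decidable (\<lambda>e. \<forall>u<e 0. \<forall>v<e 0. \<forall>u'<e 0. \<forall>v'<e 0.
      (u, v) \<in> coded_rel (e 0) \<longrightarrow> (u', v') \<in> coded_rel (e 0) \<longrightarrow> (u = u' \<longleftrightarrow> v = v'))"
    by (intro computable_intros decidable_coded_rel)
  then show ?thesis
    unfolding eq[symmetric] by (rule decidable_comp1[OF _ assms])
qed

lemma decidable_covers_upto_coded_rel:
  assumes "computable f" and "computable g"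
  shows "decidable (\<lambda>e. covers_upto (coded_rel (f e)) (g e))"
proof -
  have eq: "covers_upto M n \<longleftrightarrow> (\<forall>u<Suc n. u \<in> Domain M \<and> u \<in> Range M)" for M n
    unfolding covers_upto_def by auto
  have "decidable (\<lambda>e. \<forall>u<Suc (e 1). u \<in> Domain (coded_rel (e 0)) \<and> u \<in> Range (coded_rel (e 0)))"
    by (intro computable_intros decidable_Domain_coded_rel decidable_Range_coded_rel)
  then show ?thesis
    unfolding eq[symmetric] by (rule decidable_comp2[OF _ assms])
qed

section \<open>Certificates and the stepwise construction\<close>

text \<open>The code \<open>a\<close> exceeds both the entries and the number of vertices of the coded relation, so it
  also serves as starting point and number of the layers in \<open>hall_residual\<close>.\<close>

definition certifies :: "(nat \<times> nat) set \<Rightarrow> (nat \<Rightarrow> nat) \<Rightarrow> nat \<Rightarrow> nat \<Rightarrow> bool" where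
  "certifies E \<beta> b a \<longleftrightarrow> coded_rel a \<subseteq> coded_rel b \<and> coded_rel b \<subseteq> E \<and>
     matching (coded_rel b) \<and> covers_upto (coded_rel b) ((\<beta> ^^ (2 * a)) a)"

lemma decidable_certifies:
  assumes "decidable (\<lambda>e. (e 0, e 1) \<in> E)" and "computable (\<lambda>e. \<beta> (e 0))"
    and "computable f" and "computable g"
  shows "decidable (\<lambda>e. certifies E \<beta> (f e) (g e))"
proof -
  have eq: "(\<beta> ^^ n) x = rec_nat x (\<lambda>_ r. \<beta> r) n" for n x
    by (induction n) auto
  have "computable (\<lambda>e. rec_nat (e 1) (\<lambda>_ r. \<beta> r) (2 * e 1))"
    by (intro computable_rec_nat computable_comp1[of \<beta>, OF assms(2) computable_var]
        computable_intros)
  then have "computable (\<lambda>e. (\<beta> ^^ (2 * e 1)) (e 1))" unfolding eq .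
  then have "decidable (\<lambda>e. certifies E \<beta> (e 0) (e 1))"
    unfolding certifies_def
    by (intro computable_intros decidable_coded_rel_subset decidable_coded_rel_subset'[OF assms(1)]
        decidable_matching_coded_rel decidable_covers_upto_coded_rel)
  then show ?thesis by (rule decidable_comp2[OF _ assms(3,4)])
qed

text \<open>The certificate feeds \<open>hall_residual\<close> on both sides, for \<open>E\<close>
  and for its converse, which gives the two Hall conditions of \<open>extendableI\<close>.\<close>

lemma extendable_certified:
  assumes lb: "locally_bounded E \<beta>"
    and expand: "doubling E" "doubling (E\<inverse>)"
    and cert: "certifies E \<beta> b a"
  shows "extendable E (coded_rel a)"
proof (rule extendableI)
  have cert: "coded_rel a \<subseteq> coded_rel b" "coded_rel b \<subseteq> E" "matching (coded_rel b)"
      "{..(\<beta> ^^ (2 * a)) a} \<subseteq> Domain (coded_rel b)" "{..(\<beta> ^^ (2 * a)) a} \<subseteq> Range (coded_rel b)"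
    using cert unfolding certifies_def covers_upto_def by auto
  show "matching (coded_rel a)" using cert(1,3) by (rule matching_subset[rotated])
  show "coded_rel a \<subseteq> E" using cert(1,2) by blast
  have card: "card A \<le> a" if "A \<subseteq> {..<a}" for A
    using card_mono[OF finite_lessThan that] by simp
  have le: "{..<a} \<subseteq> {..a}" by auto
  fix A :: "nat set"
  assume A: "finite A"
  show "card A \<le> card (E `` A - Range (coded_rel a))" if "A \<inter> Domain (coded_rel a) = {}"
    by (rule hall_residual[where \<beta> = \<beta> and z = a and M' = "coded_rel b",
          OF lb expand(1) subset_trans[OF Range_coded_rel le] card[OF Range_coded_rel]
          cert(3,1,2,4) A that])
  show "card A \<le> card (E\<inverse> `` A - Domain (coded_rel a))" if "A \<inter> Range (coded_rel a) = {}"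
  proof -
    have "card A \<le> card (E\<inverse> `` A - Range ((coded_rel a)\<inverse>))"
    proof (rule hall_residual[where \<beta> = \<beta> and z = a and M' = "(coded_rel b)\<inverse>"])
      show "Range ((coded_rel a)\<inverse>) \<subseteq> {..a}" "card (Range ((coded_rel a)\<inverse>)) \<le> a"
        using Domain_coded_rel[of a] card[OF Domain_coded_rel] le by auto
    qed (use locally_bounded_converse[OF lb] expand cert A that matching_converse in auto)
    then show ?thesis by simp
  qed
next
  fix u show "finite (E `` {u})" by (rule finite_Image_locally_bounded[OF lb]) simp
next
  fix v show "finite (E\<inverse> `` {v})" 
    by (rule finite_Image_locally_bounded[OF locally_bounded_converse[OF lb]]) simp
qed (rule finite_coded_rel)

text \<open>There is a circularity: how far \<open>M'\<close> must cover depends on the code of the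
  next matching, whose new edges are taken from \<open>M'\<close>. As the partners of
  \<open>n\<close> are at most \<open>\<beta> n\<close>, there are finitely many candidates, and
  \<open>M'\<close> is chosen to serve all of them.\<close>

lemma extendable_step:
  assumes lb: "locally_bounded E \<beta>"
    and M: "finite M" and ext: "extendable E M"
  shows "\<exists>a b. M \<subseteq> coded_rel a \<and> n \<in> Domain (coded_rel a) \<and> n \<in> Range (coded_rel a) \<and>
    certifies E \<beta> b a"
proof -
  note bound = locally_boundedD[OF lb]
  define code where "code = (\<lambda>M :: (nat \<times> nat) set. set_encode (prod_encode ` M))"
  define S where "S = Pow (M \<union> {..\<beta> n} \<times> {..\<beta> n})"
  have S: "finite S" using M by (simp add: S_def)
  \<comment> \<open>Beyond the demands of all candidates, and at least \<open>n\<close>, so that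
    \<open>M'\<close> covers \<open>n\<close>.\<close>
  define k where "k = Max (insert n ((\<lambda>N. (\<beta> ^^ (2 * code N)) (code N)) ` S))"
  obtain M' where M': "finite M'" "matching M'" "M \<subseteq> M'" "M' \<subseteq> E" "covers_upto M' k"
    using ext unfolding extendable_def by blast
  have "n \<le> k" using S by (simp add: k_def)
  then obtain u v where uv: "(n, v) \<in> M'" "(u, n) \<in> M'"
    using M'(5) unfolding covers_upto_def by blast
  define N where "N = M \<union> {(n, v), (u, n)}"
  have "v \<le> \<beta> n" "u \<le> \<beta> n" using uv M'(4) bound(1,2) by blast+
  then have "N \<in> S" using bound(3)[of n] by (auto simp: N_def S_def)
  then have "(\<beta> ^^ (2 * code N)) (code N) \<le> k" using S by (auto simp: k_def)
  moreover have "coded_rel (code N) = N" "coded_rel (code M') = M'"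
    using M M'(1) unfolding code_def by (intro coded_rel_surj; simp add: N_def)+
  moreover have "N \<subseteq> M'" using M'(3) uv by (simp add: N_def)
  moreover have "n \<in> Domain N" "n \<in> Range N" "M \<subseteq> N" by (auto simp: N_def)
  ultimately have "M \<subseteq> coded_rel (code N)" "n \<in> Domain (coded_rel (code N))"
      "n \<in> Range (coded_rel (code N))" "certifies E \<beta> (code M') (code N)"
    using M' unfolding certifies_def covers_upto_def by auto
  then show ?thesis by blast
qed

text \<open>A state codes a finite matching with a certificate. Step \<open>n\<close> covers the
  vertex \<open>n\<close> on both sides, and the certificate preserves extendability, so the next
  search halts too. The union of the stages is the graph of \<open>f\<close>.\<close>

theorem computable_perfect_matching:
  assumes dec: "decidable (\<lambda>e. (e 0, e 1) \<in> E)" "computable (\<lambda>e. \<beta> (e 0))"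
    and lb: "locally_bounded E \<beta>"
    and expand: "doubling E" "doubling (E\<inverse>)"
  shows "\<exists>f. bij f \<and> computable (\<lambda>e. f (e 0)) \<and> (\<forall>u. (u, f u) \<in> E)"
proof -
  define P where "P n x y \<longleftrightarrow> (let M = coded_rel (fst (prod_decode x));
      a = fst (prod_decode y); b = snd (prod_decode y) in
      M \<subseteq> coded_rel a \<and> n \<in> Domain (coded_rel a) \<and> n \<in> Range (coded_rel a) \<and> certifies E \<beta> b a)"
    for n x y
  define I where "I = (\<lambda>(n::nat) x. extendable E (coded_rel (fst (prod_decode x))))"
  have "\<exists>\<sigma>. computable (\<lambda>e. \<sigma> (e 0)) \<and> \<sigma> 0 = 0 \<and> (\<forall>n. I n (\<sigma> n) \<and> P n (\<sigma> n) (\<sigma> (Suc n)))"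
  proof (rule computable_iterate)
    show "decidable (\<lambda>e. P (e 1) (e 2) (e 0))"
      unfolding P_def Let_def
      by (intro computable_intros decidable_coded_rel_subset decidable_Domain_coded_rel
          decidable_Range_coded_rel decidable_certifies dec computable_fst_prod_decode
          computable_snd_prod_decode)
    \<comment> \<open>The start value 0 decodes to the empty matching.\<close>
    have "fst (prod_decode 0) = 0"
      using le_prod_encode_1[of "fst (prod_decode 0)" "snd (prod_decode 0)"] by simp
    then have "coded_rel (fst (prod_decode 0)) = {}" by (simp add: coded_rel_def)
    moreover have "extendable E {}"
    proof (rule extendableI)
      fix A :: "nat set" assume "finite A"
      then show "card A \<le> card (E `` A - Range {})" "card A \<le> card (E\<inverse> `` A - Domain {})"
        using expand unfolding doubling_def by (auto dest!: spec[of _ A])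
    next
      fix u show "finite (E `` {u})" by (rule finite_Image_locally_bounded[OF lb]) simp
    next
      fix v show "finite (E\<inverse> `` {v})"
        
    by (rule finite_Image_locally_bounded[OF locally_bounded_converse[OF lb]]) simp
    qed (auto simp: matching_empty)
    ultimately show "I 0 0" by (simp add: I_def)
    show "\<exists>y. P n x y" if I: "I n x" for n x
    proof -
      obtain a b where "coded_rel (fst (prod_decode x)) \<subseteq> coded_rel a"
          "n \<in> Domain (coded_rel a)" "n \<in> Range (coded_rel a)" "certifies E \<beta> b a"
        using extendable_step[OF lb finite_coded_rel I[unfolded I_def]] by blast
      then have "P n x (prod_encode (a, b))" by (simp add: P_def)
      then show ?thesis ..
    qed
    show "I (Suc n) y" if "P n x y" for n x y
      using that extendable_certified[OF lb expand] unfolding P_def I_def Let_def by blast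
  qed
  then obtain \<sigma> where \<sigma>: "computable (\<lambda>e. \<sigma> (e 0))" "\<And>n. P n (\<sigma> n) (\<sigma> (Suc n))" by blast
  define M where "M n = coded_rel (fst (prod_decode (\<sigma> n)))" for n
  have M: "M n \<subseteq> M (Suc n)" "n \<in> Domain (M (Suc n))" "n \<in> Range (M (Suc n))"
    "matching (M (Suc n))" "M (Suc n) \<subseteq> E" for n
    using \<sigma>(2)[of n] unfolding P_def M_def Let_def certifies_def
    by (auto intro: matching_subset)
  have mono: "M m \<subseteq> M n" if "m \<le> n" for m n
    using that M(1) by (rule lift_Suc_mono_le[rotated])
  have unique: "u = u' \<longleftrightarrow> v = v'" if "(u, v) \<in> M m" "(u', v') \<in> M n" for u v u' v' m n
  proof -
    have "M m \<subseteq> M (Suc (max m n))" "M n \<subseteq> M (Suc (max m n))"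
      by (rule mono, simp)+
    then have "(u, v) \<in> M (Suc (max m n))" "(u', v') \<in> M (Suc (max m n))"
      using that by blast+
    then show ?thesis using M(4)[of "max m n"] unfolding matching_def by blast
  qed
  \<comment> \<open>Vertex \<open>u\<close> is covered at stage \<open>Suc u\<close> and keeps its
    partner later, so the search halts with the final value.\<close>
  define f where "f u = (LEAST v. (u, v) \<in> M (Suc u))" for u
  have f: "(u, f u) \<in> M (Suc u)" for u
    unfolding f_def using M(2)[of u] by (auto intro: LeastI)
  have "inj f" using f unique by (meson injI)
  moreover have "surj f"
  proof (rule surjI)
    fix v
    obtain u where "(u, v) \<in> M (Suc v)" using M(3)[of v] by blast
    then show "f (SOME u. (u, v) \<in> M (Suc v)) = v"
      using f unique by (metis someI)
  qed
  moreover have "computable (\<lambda>e. f (e 0))"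
    unfolding f_def
  proof (rule computable_Least)
    show "decidable (\<lambda>e. (e (Suc 0), e 0) \<in> M (Suc (e (Suc 0))))"
      unfolding M_def
      by (intro decidable_coded_rel computable_fst_prod_decode computable_comp1[OF \<sigma>(1)]
          computable_Suc computable_var)
    show "\<exists>v. (e 0, v) \<in> M (Suc (e 0))" for e using f by blast
  qed
  moreover have "(u, f u) \<in> E" for u using f M(5) by blast
  ultimately show ?thesis unfolding bij_def by blast
qed

section \<open>Expansion in pseudogroups\<close>

lemma map_inv_eq_Some_iff:
  assumes "partial_bij \<rho>"
  shows "map_inv \<rho> y = Some x \<longleftrightarrow> \<rho> x = Some y"
proof -
  have unique: "x = x'" if "\<rho> x = Some y" "\<rho> x' = Some y" for x x'
    using assms that unfolding partial_bij_def inj_on_def by (metis domI)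
  then have "(THE x. \<rho> x = Some y) = x" if "\<rho> x = Some y" for x
    using that by blast
  then show ?thesis unfolding map_inv_def ran_def by auto
qed

section \<open>Closure properties of computable pseudogroups\<close>

context
  fixes G :: "(nat \<rightharpoonup> nat) set"
  assumes G: "computable_pseudogroup G"
begin

lemma computable_trans_mem: "\<rho> \<in> G \<Longrightarrow> computable_trans \<rho>"
  using G unfolding computable_pseudogroup_def by blast

lemma partial_bij_mem: "\<rho> \<in> G \<Longrightarrow> partial_bij \<rho>"
  using G unfolding computable_pseudogroup_def pseudogroup_wrt_def by blast

lemma Some_mem: "Some \<in> G"
  using G unfolding computable_pseudogroup_def pseudogroup_wrt_def by blast

lemma map_inv_mem: "\<rho> \<in> G \<Longrightarrow> map_inv \<rho> \<in> G"
  using G unfolding computable_pseudogroup_def pseudogroup_wrt_def by blast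

lemma restrict_mem: "\<rho> \<in> G \<Longrightarrow> computable_set S \<Longrightarrow> S \<subseteq> dom \<rho> \<Longrightarrow> \<rho> |` S \<in> G"
  using G unfolding computable_pseudogroup_def pseudogroup_wrt_def by blast

text \<open>The axiom composes only maps with matching range and domain. Both factors are cut down
  to the points through which the composition passes; these sets are computable, so the restrictions
  stay in \<open>G\<close>.\<close>

lemma map_comp_mem:
  assumes "\<rho> \<in> G" and "\<sigma> \<in> G"
  shows "\<rho> \<circ>\<^sub>m \<sigma> \<in> G"
proof -
  have dec: "decidable (\<lambda>e. e 0 \<in> dom \<rho>)" "decidable (\<lambda>e. e 0 \<in> dom \<sigma>)"
      "decidable (\<lambda>e. e 0 \<in> ran \<sigma>)" "partial_computable \<sigma>" "computable_set (dom \<sigma>)"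
    using assms[THEN computable_trans_mem] unfolding decidable_set_iff computable_trans_def
    by blast+
  define h where "h x = (case \<sigma> x of None \<Rightarrow> 0 | Some y \<Rightarrow> y)" for x
  have "computable (\<lambda>e. h (e 0))"
    unfolding h_def by (rule computable_the_partial[OF dec(4,5)])
  then have "decidable (\<lambda>e. e 0 \<in> dom \<sigma> \<and> h (e 0) \<in> dom \<rho>)"
    by (intro decidable_conj dec(2) decidable_comp1[OF dec(1)])
  moreover have "(x \<in> dom \<sigma> \<and> h x \<in> dom \<rho>) = (x \<in> dom (\<rho> \<circ>\<^sub>m \<sigma>))" for x
    by (auto simp: h_def map_comp_def dom_def split: option.splits)
  ultimately have S: "computable_set (dom (\<rho> \<circ>\<^sub>m \<sigma>))"
    unfolding decidable_set_iff[symmetric] by simp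
  have "decidable (\<lambda>e. e 0 \<in> ran \<sigma> \<inter> dom \<rho>)"
    using decidable_conj[OF dec(3,1)] by simp
  then have T: "computable_set (ran \<sigma> \<inter> dom \<rho>)"
    by (simp only: decidable_set_iff)
  have "\<sigma> |` dom (\<rho> \<circ>\<^sub>m \<sigma>) \<in> G"
    by (rule restrict_mem[OF assms(2) S]) (auto simp: map_comp_Some_iff)
  moreover have "\<rho> |` (ran \<sigma> \<inter> dom \<rho>) \<in> G"
    by (rule restrict_mem[OF assms(1) T]) auto
  moreover have "ran (\<sigma> |` dom (\<rho> \<circ>\<^sub>m \<sigma>)) = dom (\<rho> |` (ran \<sigma> \<inter> dom \<rho>))"
    by (auto simp: ran_def restrict_map_def map_comp_Some_iff split: if_splits)
      (metis domI map_comp_Some_iff)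
  ultimately have "\<rho> |` (ran \<sigma> \<inter> dom \<rho>) \<circ>\<^sub>m \<sigma> |` dom (\<rho> \<circ>\<^sub>m \<sigma>) \<in> G"
    using G unfolding computable_pseudogroup_def pseudogroup_wrt_def by blast
  moreover have "\<rho> |` (ran \<sigma> \<inter> dom \<rho>) \<circ>\<^sub>m \<sigma> |` dom (\<rho> \<circ>\<^sub>m \<sigma>) = \<rho> \<circ>\<^sub>m \<sigma>"
  proof
    fix x
    show "(\<rho> |` (ran \<sigma> \<inter> dom \<rho>) \<circ>\<^sub>m \<sigma> |` dom (\<rho> \<circ>\<^sub>m \<sigma>)) x = (\<rho> \<circ>\<^sub>m \<sigma>) x"
      by (auto simp: map_comp_def restrict_map_def dom_def ran_def split: option.splits)
  qed
  ultimately show ?thesis by simp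
qed

text \<open>The elements of \<open>W\<close> may agree with \<open>\<gamma>\<close> on overlapping
  sets. Splitting \<open>dom \<gamma>\<close> by the exact set \<open>K\<close> of those agreeing at
  a point makes the pieces disjoint, and on a non-empty piece \<open>\<gamma>\<close> coincides with
  any member of \<open>K\<close>.\<close>

lemma glue_mem:
  assumes W: "finite W" "W \<subseteq> G" and bij: "partial_bij \<gamma>"
    and cover: "\<And>x. x \<in> dom \<gamma> \<Longrightarrow> \<exists>\<omega>\<in>W. \<omega> x = \<gamma> x"
    and dec: "\<And>\<omega>. \<omega> \<in> W \<Longrightarrow> computable_set {x \<in> dom \<gamma>. \<omega> x = \<gamma> x}"
  shows "\<gamma> \<in> G"
proof -
  define part where "part K = {x \<in> dom \<gamma>. {\<omega> \<in> W. \<omega> x = \<gamma> x} = K}" for K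
  define P where "P = part ` Pow W - {{}}"
  have dec: "decidable (\<lambda>e. e 0 \<in> dom \<gamma> \<and> \<omega> (e 0) = \<gamma> (e 0))" if "\<omega> \<in> W" for \<omega>
    using dec[OF that] by (simp add: decidable_set_iff[symmetric])
  have part: "computable_set (part K)" if K: "K \<subseteq> W" for K
  proof -
    \<comment> \<open>By \<open>cover\<close>, the first conjunct expresses membership in
      \<open>dom \<gamma>\<close>; the second alone would admit outside points when \<open>K\<close>
      is empty.\<close>
    have "decidable (\<lambda>e. (\<exists>\<omega>\<in>W. e 0 \<in> dom \<gamma> \<and> \<omega> (e 0) = \<gamma> (e 0)) \<and>
        (\<forall>\<omega>\<in>W. (e 0 \<in> dom \<gamma> \<and> \<omega> (e 0) = \<gamma> (e 0)) = (\<omega> \<in> K)))"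
      by (intro decidable_conj decidable_finite_bex[OF W(1)] decidable_finite_ball[OF W(1)]
          decidable_iff decidable_const dec)
    moreover have "(\<exists>\<omega>\<in>W. x \<in> dom \<gamma> \<and> \<omega> x = \<gamma> x) \<and>
        (\<forall>\<omega>\<in>W. (x \<in> dom \<gamma> \<and> \<omega> x = \<gamma> x) = (\<omega> \<in> K)) \<longleftrightarrow> x \<in> part K" for x
      using cover[of x] K unfolding part_def by blast
    ultimately show ?thesis by (simp only: decidable_set_iff)
  qed
  have "finite P" using W(1) by (simp add: P_def)
  moreover have "partition_on (dom \<gamma>) P"
  proof (rule partition_onI)
    show "\<Union>P = dom \<gamma>"
    proof
      show "\<Union>P \<subseteq> dom \<gamma>" by (auto simp: P_def part_def)
      show "dom \<gamma> \<subseteq> \<Union>P"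
      proof
        fix x assume "x \<in> dom \<gamma>"
        then have x: "x \<in> part {\<omega> \<in> W. \<omega> x = \<gamma> x}" by (simp add: part_def)
        then have "part {\<omega> \<in> W. \<omega> x = \<gamma> x} \<in> P" unfolding P_def by blast
        with x show "x \<in> \<Union>P" by blast
      qed
    qed
    show "disjnt S T" if "S \<in> P" "T \<in> P" "S \<noteq> T" for S T
      using that unfolding P_def part_def disjnt_def by fastforce
    show "{} \<notin> P" by (simp add: P_def)
  qed
  moreover have "\<gamma> |` S \<in> G" if S: "S \<in> P" for S
  proof -
    obtain K where K: "K \<subseteq> W" "S = part K" using S by (auto simp: P_def)
    obtain x where x: "x \<in> S" using S by (auto simp: P_def)
    then obtain \<omega> where \<omega>: "\<omega> \<in> K" using cover K(2) unfolding part_def by blast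
    have eq: "\<omega> y = \<gamma> y" "y \<in> dom \<gamma>" if "y \<in> S" for y
      using that \<omega> K(2) unfolding part_def by blast+
    then have "S \<subseteq> dom \<omega>" by (metis domIff subsetI)
    then have "\<omega> |` S \<in> G"
      using restrict_mem part[OF K(1)] \<omega> K W(2) by blast
    moreover have "\<omega> |` S = \<gamma> |` S" using eq(1) by (auto simp: restrict_map_def)
    ultimately show ?thesis by simp
  qed
  moreover have "\<forall>\<rho> P. partial_bij \<rho> \<and> finite P \<and> partition_on (dom \<rho>) P \<and>
      (\<forall>S\<in>P. \<rho> |` S \<in> G) \<longrightarrow> \<rho> \<in> G"
    using G unfolding computable_pseudogroup_def pseudogroup_wrt_def by (elim conjE)
  ultimately show ?thesis using bij by metis
qed

section \<open>Growth under finitely many generators\<close>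

text \<open>\<open>Some\<close> makes the relation reflexive, so that the image of a set contains
  the set.\<close>

definition moves :: "(nat \<rightharpoonup> nat) set \<Rightarrow> (nat \<times> nat) set" where
  "moves R = {(x, y). \<exists>\<rho>\<in>R \<union> map_inv ` R \<union> {Some}. \<rho> x = Some y}"

lemma sym_moves:
  assumes "R \<subseteq> G"
  shows "sym (moves R)"
proof (rule symI)
  fix x y assume "(x, y) \<in> moves R"
  then consider \<rho> where "\<rho> \<in> R" "\<rho> x = Some y" | \<rho> where "\<rho> \<in> R" "map_inv \<rho> x = Some y" | "x = y"
    unfolding moves_def by auto
  then show "(y, x) \<in> moves R"
  proof cases
    case (1 \<rho>)
    then have "map_inv \<rho> y = Some x"
      using assms map_inv_eq_Some_iff[OF partial_bij_mem] by (simp add: subset_iff)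
    with 1(1) show ?thesis unfolding moves_def by blast
  next
    case (2 \<rho>)
    then have "\<rho> y = Some x"
      using assms map_inv_eq_Some_iff[OF partial_bij_mem] by (simp add: subset_iff)
    with 2(1) show ?thesis unfolding moves_def by blast
  next
    case 3
    then show ?thesis unfolding moves_def by blast
  qed
qed

text \<open>The boundary collects points that move into \<open>F\<close>, the image those reached
  from \<open>F\<close>; symmetry of \<open>moves R\<close> reconciles the two.\<close>

lemma moves_Image:
  assumes "R \<subseteq> G"
  shows "moves R `` F = F \<union> boundary R F"
proof -
  have "moves R `` F = (moves R)\<inverse> `` F"
    using sym_moves[OF assms] by (simp add: sym_conv_converse_eq)
  also have "\<dots> = F \<union> boundary R F"
    unfolding moves_def boundary_def by auto
  finally show ?thesis .
qed

lemma finite_moves_Image: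
  assumes "finite R" and "finite F"
  shows "finite (moves R `` F)"
proof (rule finite_subset)
  show "moves R `` F \<subseteq> (\<Union>\<rho>\<in>R \<union> map_inv ` R \<union> {Some}. (\<lambda>x. the (\<rho> x)) ` F)"
    unfolding moves_def by force
qed (use assms in auto)

text \<open>\<open>W\<close> consists of the words of length \<open>k\<close> in the generators,
  their inverses and the identity, composed as partial maps.\<close>

lemma moves_relpow_words:
  assumes "finite R" and "R \<subseteq> G"
  shows "\<exists>W. finite W \<and> W \<subseteq> G \<and> (\<forall>x y. (x, y) \<in> moves R ^^ k \<longleftrightarrow> (\<exists>\<omega>\<in>W. \<omega> x = Some y))"
proof (induction k)
  case 0
  show ?case using Some_mem by (intro exI[of _ "{Some}"]) auto
next
  case (Suc k)
  then obtain W where W: "finite W" "W \<subseteq> G"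
    "\<And>x y. (x, y) \<in> moves R ^^ k \<longleftrightarrow> (\<exists>\<omega>\<in>W. \<omega> x = Some y)" by blast
  let ?R = "R \<union> map_inv ` R \<union> {Some}"
  have "(\<lambda>(\<rho>, \<sigma>). \<rho> \<circ>\<^sub>m \<sigma>) ` (?R \<times> W) \<subseteq> G"
    using assms(2) W(2) Some_mem map_inv_mem map_comp_mem by (auto simp: subset_iff)
  moreover have "(x, y) \<in> moves R ^^ Suc k \<longleftrightarrow>
      (\<exists>\<omega>\<in>(\<lambda>(\<rho>, \<sigma>). \<rho> \<circ>\<^sub>m \<sigma>) ` (?R \<times> W). \<omega> x = Some y)" for x y
  proof -
    have "(x, y) \<in> moves R ^^ Suc k \<longleftrightarrow>
        (\<exists>z. (\<exists>\<sigma>\<in>W. \<sigma> x = Some z) \<and> (\<exists>\<rho>\<in>?R. \<rho> z = Some y))"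
      unfolding relpow.simps relcomp_unfold W(3) by (simp add: moves_def)
    also have "\<dots> \<longleftrightarrow> (\<exists>\<rho>\<in>?R. \<exists>\<sigma>\<in>W. \<exists>z. \<sigma> x = Some z \<and> \<rho> z = Some y)" by blast
    also have "\<dots> \<longleftrightarrow> (\<exists>\<rho>\<in>?R. \<exists>\<sigma>\<in>W. (\<rho> \<circ>\<^sub>m \<sigma>) x = Some y)"
      unfolding map_comp_Some_iff ..
    also have "\<dots> \<longleftrightarrow> (\<exists>\<omega>\<in>(\<lambda>(\<rho>, \<sigma>). \<rho> \<circ>\<^sub>m \<sigma>) ` (?R \<times> W). \<omega> x = Some y)"
      by (simp only: bex_simps Bex_def) (auto; metis)
    finally show ?thesis .
  qed
  ultimately show ?case
    using W(1) assms(1) by (intro exI[of _ "(\<lambda>(\<rho>, \<sigma>). \<rho> \<circ>\<^sub>m \<sigma>) ` (?R \<times> W)"]) auto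
qed

lemma sym_moves_relpow:
  assumes "R \<subseteq> G"
  shows "sym (moves R ^^ k)"
proof (induction k)
  case (Suc k)
  show ?case
  proof (rule symI)
    fix x z assume "(x, z) \<in> moves R ^^ Suc k"
    then obtain y where "(x, y) \<in> moves R ^^ k" "(y, z) \<in> moves R" by auto
    then have "(z, y) \<in> moves R" "(y, x) \<in> moves R ^^ k"
      using symD[OF sym_moves[OF assms]] symD[OF Suc] by blast+
    then show "(z, x) \<in> moves R ^^ Suc k" by (rule relpow_Suc_I2)
  qed
qed (simp add: sym_Id)

text \<open>Failure of the condition yields growth by at least \<open>q = 1 + 1 / n\<close> in one
  move, hence by more than 4 after enough moves. One factor 2 pays for the two pieces of the
  decomposition, the other is the slack used in \<open>hall_residual\<close>.\<close>

lemma expansion: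
  assumes "\<not> folner_condition G"
  shows "\<exists>E W. sym E \<and> finite W \<and> W \<subseteq> G \<and> (\<forall>x y. (x, y) \<in> E \<longleftrightarrow> (\<exists>\<omega>\<in>W. \<omega> x = Some y)) \<and>
    (\<forall>F. finite F \<longrightarrow> finite (E `` F) \<and> 4 * card F \<le> card (E `` F))"
proof -
  obtain R n where R: "finite R" "R \<subseteq> G" and n: "n \<ge> 1"
    and nf: "\<not> (\<exists>F. finite F \<and> F \<noteq> {} \<and>
      real (card (boundary R F)) < 1 / real n * real (card F))"
    using assms unfolding folner_condition_def by metis
  have bd: "1 / real n * real (card F) \<le> real (card (boundary R F))" if F: "finite F" for F
  proof (cases "F = {}")
    case False
    with nf F show ?thesis by (meson not_le)
  qed simp
  define q where "q = 1 + 1 / real n"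
  have fin: "finite ((moves R ^^ k) `` F)" if "finite F" for k F
    using that
    by (induction k) (auto simp: relcomp_Image finite_moves_Image[OF R(1)])
  have grow: "q * real (card F) \<le> real (card (moves R `` F))" if "finite F" for F
  proof -
    \<comment> \<open>An infinite boundary would have \<open>card\<close> equal to 0, so finiteness
      has to be secured first.\<close>
    have "finite (F \<union> boundary R F)"
      using finite_moves_Image[OF R(1) that] moves_Image[OF R(2), of F] by simp
    then have "card (F \<union> boundary R F) = card F + card (boundary R F)"
      by (intro card_Un_disjoint) (auto simp: boundary_def)
    then show ?thesis
      using bd[OF that] by (simp add: moves_Image[OF R(2)] q_def algebra_simps)
  qed
  have grow_pow: "q ^ k * real (card F) \<le> real (card ((moves R ^^ k) `` F))" if "finite F" for k F
  proof (induction k)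
    case (Suc k)
    have "q ^ Suc k * real (card F) = q * (q ^ k * real (card F))" by simp
    also have "\<dots> \<le> q * real (card ((moves R ^^ k) `` F))"
      using Suc by (intro mult_left_mono) (simp_all add: q_def)
    also have "\<dots> \<le> real (card (moves R `` ((moves R ^^ k) `` F)))"
      by (rule grow[OF fin[OF that]])
    also have "moves R `` ((moves R ^^ k) `` F) = (moves R ^^ Suc k) `` F"
      by (simp add: relcomp_Image)
    finally show ?case .
  qed simp
  have "1 < q" using n by (simp add: q_def)
  then obtain k where k: "4 < q ^ k" using real_arch_pow by blast
  obtain W where W: "finite W" "W \<subseteq> G"
    "\<forall>x y. (x, y) \<in> moves R ^^ k \<longleftrightarrow> (\<exists>\<omega>\<in>W. \<omega> x = Some y)"
    using moves_relpow_words[OF R, of k] by (elim exE conjE)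
  have four: "4 * card F \<le> card ((moves R ^^ k) `` F)" if F: "finite F" for F
  proof -
    have "4 * real (card F) \<le> q ^ k * real (card F)"
      using k by (intro mult_right_mono) auto
    also note grow_pow[OF F]
    finally show ?thesis by linarith
  qed
  show ?thesis
  proof (intro exI conjI)
    show "sym (moves R ^^ k)" by (rule sym_moves_relpow[OF R(2)])
    show "finite W" "W \<subseteq> G" by (fact W)+
  qed (use W(3) fin four in auto)
qed

end

section \<open>From expansion to the decomposition\<close>

lemma computable_majorant:
  assumes "computable (\<lambda>e. g (e 0))"
  obtains \<beta> :: "nat \<Rightarrow> nat" where "computable (\<lambda>e. \<beta> (e 0))" and "\<And>x n. x \<le> n \<Longrightarrow> g x \<le> \<beta> n"
proof
  \<comment> \<open>The partial sums of \<open>g\<close> dominate all earlier values.\<close>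
  let ?\<beta> = "\<lambda>n. rec_nat (g 0) (\<lambda>k r. r + g (Suc k)) n"
  show "computable (\<lambda>e. ?\<beta> (e 0))"
    by (intro computable_rec_nat computable_add computable_Suc computable_var
        computable_const computable_comp1[OF assms])
  show "g x \<le> ?\<beta> n" if "x \<le> n" for x n
    using that by (induction n) (auto simp: le_Suc_eq)
qed

lemma computable_div2:
  assumes "computable f"
  shows "computable (\<lambda>e. f e div 2)"
proof -
  have eq: "(LEAST q. n < 2 * q + 2) = n div 2" for n :: nat
    by (rule Least_equality) auto
  have "computable (\<lambda>e. LEAST q. e 0 < 2 * q + 2)"
  proof (rule computable_Least)
    show "decidable (\<lambda>e. e (Suc 0) < 2 * e 0 + 2)" by (intro computable_intros)
    show "\<exists>q. e 0 < 2 * q + 2" for e :: "nat \<Rightarrow> nat" by (rule exI[of _ "e 0"]) simp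
  qed
  then show ?thesis unfolding eq by (rule computable_comp1[OF _ assms])
qed

lemma card_le_card_div2:
  assumes "finite A"
  shows "card A \<le> 2 * card ((\<lambda>u::nat. u div 2) ` A)"
proof -
  let ?B = "(\<lambda>u. u div 2) ` A"
  have "A \<subseteq> (\<lambda>y. 2 * y) ` ?B \<union> (\<lambda>y. 2 * y + 1) ` ?B"
  proof
    fix u assume "u \<in> A"
    then have "u div 2 \<in> ?B" by blast
    moreover have "u = 2 * (u div 2) \<or> u = 2 * (u div 2) + 1" by linarith
    ultimately show "u \<in> (\<lambda>y. 2 * y) ` ?B \<union> (\<lambda>y. 2 * y + 1) ` ?B" by blast
  qed
  then have "card A \<le> card ((\<lambda>y. 2 * y) ` ?B \<union> (\<lambda>y. 2 * y + 1) ` ?B)"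
    using assms by (intro card_mono) auto
  also have "\<dots> \<le> card ((\<lambda>y. 2 * y) ` ?B) + card ((\<lambda>y. 2 * y + 1) ` ?B)" by (rule card_Un_le)
  also have "\<dots> \<le> 2 * card ?B"
    using card_image_le[of ?B "\<lambda>y. 2 * y"] card_image_le[of ?B "\<lambda>y. 2 * y + 1"] assms by simp
  finally show ?thesis .
qed

text \<open>Each left vertex of \<open>E\<close> is split into two copies. This halves the expansion
  on the left, from 4 to 2, and only enlarges the neighbourhoods of right vertices.\<close>

lemma two_to_one_matching:
  assumes W: "finite W" "\<And>\<omega>. \<omega> \<in> W \<Longrightarrow> computable_trans \<omega>"
    and E: "\<And>x y. (x, y) \<in> E \<longleftrightarrow> (\<exists>\<omega>\<in>W. \<omega> x = Some y)" and sym: "sym E"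
    and fin: "\<And>F. finite F \<Longrightarrow> finite (E `` F)"
    and expand: "\<And>F. finite F \<Longrightarrow> 4 * card F \<le> card (E `` F)"
  shows "\<exists>f. bij f \<and> computable (\<lambda>e. f (e 0)) \<and> (\<forall>u. (u div 2, f u) \<in> E)"
proof -
  \<comment> \<open>The sum over \<open>W\<close> dominates every neighbour of
    \<open>x\<close>.\<close>
  define h where "h x = (\<Sum>\<omega>\<in>W. case \<omega> x of None \<Rightarrow> 0 | Some y \<Rightarrow> y)" for x
  have "computable (\<lambda>e. h (e 0))"
    unfolding h_def using W
    by (intro computable_finite_sum computable_the_partial) (auto simp: computable_trans_def)
  then obtain \<beta> where \<beta>: "computable (\<lambda>e. \<beta> (e 0))" "\<And>x n. x \<le> n \<Longrightarrow> h x \<le> \<beta> n"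
    by (rule computable_majorant) blast
  have bound: "y \<le> \<beta> n" if xy: "(x, y) \<in> E" "x \<le> n" for x y n
  proof -
    obtain \<omega> where \<omega>: "\<omega> \<in> W" "\<omega> x = Some y" using xy(1) E by blast
    have "(case \<omega> x of None \<Rightarrow> 0 | Some y \<Rightarrow> y) \<le> h x"
      unfolding h_def using \<omega>(1) W(1) by (intro member_le_sum) auto
    then show ?thesis using \<omega>(2) \<beta>(2)[OF xy(2)] by simp
  qed
  have le_of_div2: "u \<le> 2 * b + 1" if "u div 2 \<le> b" for u b :: nat
    using that by linarith
  \<comment> \<open>\<open>2 * y\<close> and \<open>2 * y + 1\<close> are the two copies of
    \<open>y\<close>.\<close>
  define D where "D = {(u, v). (u div 2, v) \<in> E}"
  have "\<exists>f. bij f \<and> computable (\<lambda>e. f (e 0)) \<and> (\<forall>u. (u, f u) \<in> D)"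
  \<comment> \<open>Undoing the halving turns a bound \<open>b\<close> into
    \<open>2 * b + 1\<close>; the summand \<open>n\<close> keeps the bound above
    \<open>n\<close>.\<close>
  proof (rule computable_perfect_matching[where \<beta> = "\<lambda>n. 2 * (\<beta> n + n) + 1"])
    have "decidable (\<lambda>e. \<exists>\<omega>\<in>W. \<omega> (e 0 div 2) = Some (e 1))"
      using W by (intro decidable_finite_bex decidable_graph computable_div2 computable_var) auto
    then show "decidable (\<lambda>e. (e 0, e 1) \<in> D)" by (simp add: D_def E)
    show "computable (\<lambda>e. 2 * (\<beta> (e 0) + e 0) + 1)"
      by (intro computable_intros \<beta>(1))
    have "v \<le> 2 * (\<beta> n + n) + 1" if "(u, v) \<in> D" "u \<le> n" for u v n
    proof -
      have "v \<le> \<beta> n" using bound[of "u div 2" v n] that by (simp add: D_def)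
      then show ?thesis by simp
    qed
    moreover have "u \<le> 2 * (\<beta> n + n) + 1" if "(u, v) \<in> D" "v \<le> n" for u v n
    proof -
      have "u div 2 \<le> \<beta> n" using bound[of v "u div 2" n] that symD[OF sym] by (simp add: D_def)
      from le_of_div2[OF this] show ?thesis by simp
    qed
    ultimately show "locally_bounded D (\<lambda>n. 2 * (\<beta> n + n) + 1)"
      unfolding locally_bounded_def by fastforce
    show "doubling D"
      unfolding doubling_def
    proof (intro allI impI)
      fix A :: "nat set" assume A: "finite A"
      have "D `` A = E `` ((\<lambda>u. u div 2) ` A)" by (auto simp: D_def)
      then show "2 * card A \<le> card (D `` A)"
        using card_le_card_div2[OF A] expand[of "(\<lambda>u. u div 2) ` A"] A by simp
    qed
    show "doubling (D\<inverse>)"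
      unfolding doubling_def
    proof (intro allI impI)
      fix A :: "nat set" assume A: "finite A"
      have D: "D\<inverse> `` A = (\<lambda>u. u div 2) -` (E `` A)"
        using sym by (auto simp: D_def sym_def)
      have "finite (D\<inverse> `` A)"
      proof (rule finite_subset)
        show "D\<inverse> `` A \<subseteq> {..2 * Max (E `` A) + 1}"
        proof
          fix u assume "u \<in> D\<inverse> `` A"
          then have "u div 2 \<le> Max (E `` A)" using fin[OF A] by (simp add: D)
          then show "u \<in> {..2 * Max (E `` A) + 1}" using le_of_div2 by simp
        qed
      qed simp
      \<comment> \<open>The even copies of the neighbours already suffice.\<close>
      then have "card ((\<lambda>y. 2 * y) ` (E `` A)) \<le> card (D\<inverse> `` A)"
        by (rule card_mono) (auto simp: D)
      then have "card (E `` A) \<le> card (D\<inverse> `` A)" by (simp add: card_image inj_on_def)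
      then show "2 * card A \<le> card (D\<inverse> `` A)" using expand[OF A] by linarith
    qed
  qed
  then show ?thesis by (simp add: D_def)
qed

theorem theorem3p2:
  fixes G :: "(nat \<rightharpoonup> nat) set"
  assumes "computable_pseudogroup G"
    and "\<not> folner_condition G"
  shows "\<exists>X\<^sub>1 X\<^sub>2 \<gamma>\<^sub>1 \<gamma>\<^sub>2. effective_paradoxical_decomposition G X\<^sub>1 X\<^sub>2 \<gamma>\<^sub>1 \<gamma>\<^sub>2"
proof -
  note trans = computable_trans_mem[OF assms(1)]
  obtain E W where sym: "sym E" and W: "finite W" "W \<subseteq> G"
    and E: "\<forall>x y. (x, y) \<in> E \<longleftrightarrow> (\<exists>\<omega>\<in>W. \<omega> x = Some y)"
    and EF: "\<forall>F. finite F \<longrightarrow> finite (E `` F) \<and> 4 * card F \<le> card (E `` F)"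
    using expansion[OF assms] by (elim exE conjE)
  have transW: "computable_trans \<omega>" if "\<omega> \<in> W" for \<omega> using that W(2) trans by blast
  have "\<exists>f. bij f \<and> computable (\<lambda>e. f (e 0)) \<and> (\<forall>u. (u div 2, f u) \<in> E)"
    by (rule two_to_one_matching[OF W(1) transW _ sym]) (use E EF in auto)
  then obtain f where f: "bij f" "computable (\<lambda>e. f (e 0))" "\<And>u. (u div 2, f u) \<in> E"
    by blast
  define g where "g = inv f"
  have fg: "f (g v) = v" "g (f u) = u" for u v
    using f(1) by (simp_all add: g_def bij_is_surj bij_is_inj surj_f_inv_f)
  \<comment> \<open>The inverse of a computable bijection is found by search.\<close>
  have "(LEAST u. f u = v) = g v" for v
    by (rule Least_equality) (use fg in auto)
  moreover have "computable (\<lambda>e. LEAST u. f u = e 0)"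
  proof (rule computable_Least)
    show "decidable (\<lambda>e. f (e 0) = e (Suc 0))" by (intro computable_intros f(2))
    show "\<exists>u. f u = e 0" for e using fg(1) by blast
  qed
  ultimately have g: "computable (\<lambda>e. g (e 0))" by simp
  \<comment> \<open>\<open>X 0\<close> and \<open>X 1\<close> are the images under \<open>f\<close>
    of the even and the odd numbers; for larger \<open>i\<close> the set is empty.\<close>
  define X where "X i = {v. g v = 2 * (g v div 2) + i}" for i
  define \<gamma> where "\<gamma> i v = (if v \<in> X i then Some (g v div 2) else None)" for i v
  have decX: "decidable (\<lambda>e. e 0 \<in> X i)" for i
    unfolding X_def mem_Collect_eq by (intro computable_intros computable_div2 g)
  have dom: "dom (\<gamma> i) = X i" for i by (auto simp: \<gamma>_def split: if_splits)
  have fX: "f (2 * y + i) \<in> X i" "\<gamma> i (f (2 * y + i)) = Some y" if "i < 2" for i y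
    using that by (auto simp: \<gamma>_def X_def fg)
  have ran: "ran (\<gamma> i) = UNIV" if "i < 2" for i
    using fX(2)[OF that] by (auto intro: ranI)
  have mem: "\<gamma> i \<in> G" for i
  proof (rule glue_mem[OF assms(1) W])
    show "partial_bij (\<gamma> i)"
      unfolding partial_bij_def dom
    proof (rule inj_onI)
      fix v w assume "v \<in> X i" "w \<in> X i" "\<gamma> i v = \<gamma> i w"
      then have "g v = g w" by (simp add: \<gamma>_def X_def)
      then show "v = w" by (metis fg(1))
    qed
    show "\<exists>\<omega>\<in>W. \<omega> v = \<gamma> i v" if "v \<in> dom (\<gamma> i)" for v
    proof -
      \<comment> \<open>The matching leads from \<open>g v div 2\<close> to \<open>v\<close>,
        whereas \<open>\<gamma> i\<close> goes back, so symmetry of \<open>E\<close> supplies the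
        word.\<close>
      have "(v, g v div 2) \<in> E" using f(3)[of "g v"] sym by (simp add: fg symD)
      then show ?thesis using E that unfolding dom by (auto simp: \<gamma>_def)
    qed
    show "computable_set {v \<in> dom (\<gamma> i). \<omega> v = \<gamma> i v}" if "\<omega> \<in> W" for \<omega>
    proof -
      have "decidable (\<lambda>e. e 0 \<in> X i \<and> \<omega> (e 0) = Some (g (e 0) div 2))"
        by (intro decidable_conj decX decidable_graph[OF transW[OF that]] computable_var
            computable_div2 g)
      moreover have "v \<in> X i \<and> \<omega> v = Some (g v div 2) \<longleftrightarrow>
          v \<in> {v \<in> dom (\<gamma> i). \<omega> v = \<gamma> i v}" for v
        unfolding dom by (auto simp: \<gamma>_def)
      ultimately show ?thesis by (simp only: decidable_set_iff)
    qed
  qed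
  have "X 0 \<union> X 1 = UNIV" "X 0 \<inter> X 1 = {}"
    unfolding X_def by (auto; presburger)+
  moreover have "X 0 \<noteq> {}" "X 1 \<noteq> {}" using fX(1)[of 0] fX(1)[of 1] by auto
  moreover have "computable_set (X i)" for i using decX by (simp only: decidable_set_iff)
  ultimately have "effective_paradoxical_decomposition G (X 0) (X 1) (\<gamma> 0) (\<gamma> 1)"
    unfolding effective_paradoxical_decomposition_def using mem trans dom ran by simp
  then show ?thesis by blast
qed

end
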